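(* Let $(Q_j)_{j=1}^\infty$ be a sequence of basic sequences, each of which is infinite in limit. Suppose that at least one of the following conditions holds: (1) for every $j$, the basic sequence $Q_j$ is $1$-convergent; (2) the basic sequence $Q_1$ is $1$-divergent and there exists a basic sequence $S=(s_n)_{n=1}^\infty$ such that $Q_j \sim_{s_j} Q_{j+1}$ for every $j\ge 1$ (that is, $Q_1\sim_{s_1}Q_2\sim_{s_2}Q_3\sim_{s_3}Q_4\cdots$). Then $$\dim_{\mathrm H}\left(\bigcap_{j=1}^\infty \mathscr{DN}(Q_j)\setminus \mathscr{RN}_1(Q_j)\right)=1,$$ where $\dim_{\mathrm H}$ denotes Hausdorff dimension.
   Context: A basic sequence is a sequence $Q=(q_n)_{n=1}^\infty$ of integers $q_n\ge 2$. It is infinite in limit if $q_n\to\infty$. It is $1$-divergent if $\sum_{n=1}^\infty 1/q_n=\infty$, and $1$-convergent otherwise. The $Q$-Cantor series expansion of $x\in\mathbb R$ is the unique expansion $x=\lfloor x\rfloor+\sum_{n=1}^\infty \frac{E_n}{q_1q_2\cdots q_n}$ with $E_n\in\{0,1,\dots,q_n-1\}$ for $n\ge1$ and $E_n\ne q_n-1$ for infinitely many $n$. For a block (finite sequence) $B$ of non-negative integers, $N_n^Q(B,x)$ is the number of times $B$ occurs in the digit sequence $(E_1,E_2,\dots)$ of $x$ starting at a position no greater than $n$. $\mathscr{RN}_1(Q)$ (the set of simply $Q$-ratio normal numbers) is the set of real $x$ such that for all blocks $B_1,B_2$ of length $1$ (i.e. all single non-negative integers), $\lim_{n\to\infty}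 N_n^Q(B_1,x)/N_n^Q(B_2,x)=1$. $T_{Q,n}(x)=\left(\prod_{j=1}^n q_j\right)x \pmod 1$, and $\mathscr{DN}(Q)$ (the set of $Q$-distribution normal numbers) is the set of real $x$ such that $(T_{Q,n}(x))_{n=0}^\infty$ is uniformly distributed mod $1$. For basic sequences $P=(p_n)$, $Q=(q_n)$ and a positive integer $s$, we write $P\sim_s Q$ if $q_n=\prod_{j=1}^s p_{s(n-1)+j}$ for all $n\ge 1$. *)

theory Defs
  imports "HOL-Analysis.Analysis"
begin

text \<open>
  Sequences \<open>(q\<^sub>n)\<close>, \<open>(E\<^sub>n)\<close>, \<open>(s\<^sub>n)\<close> indexed by \<open>n \<ge> 1\<close> are functions on \<open>nat\<close>
  whose value at \<open>0\<close> is irrelevant.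
\<close>

definition basic_sequence :: "(nat \<Rightarrow> nat) \<Rightarrow> bool" where
  "basic_sequence Q \<longleftrightarrow> (\<forall>n\<ge>1. Q n \<ge> 2)"

definition infinite_in_limit :: "(nat \<Rightarrow> nat) \<Rightarrow> bool" where
  "infinite_in_limit Q \<longleftrightarrow> filterlim Q at_top sequentially"

text \<open>The terms are nonnegative, so the series diverges to infinity iff it is not summable.\<close>

definition one_divergent :: "(nat \<Rightarrow> nat) \<Rightarrow> bool" where
  "one_divergent Q \<longleftrightarrow> \<not> summable (\<lambda>n. 1 / real (Q (Suc n)))"

definition one_convergent :: "(nat \<Rightarrow> nat) \<Rightarrow> bool" where
  "one_convergent Q \<longleftrightarrow> \<not> one_divergent Q"

definition is_cantor_expansion :: "(nat \<Rightarrow> nat) \<Rightarrow> real \<Rightarrow> (nat \<Rightarrow> nat) \<Rightarrow> bool" where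
  "is_cantor_expansion Q x E \<longleftrightarrow>
     (\<forall>n\<ge>1. E n \<in> {0..Q n - 1}) \<and>
     infinite {n. n \<ge> 1 \<and> E n \<noteq> Q n - 1} \<and>
     (\<lambda>n. real (E (Suc n)) / real (\<Prod>j=1..Suc n. Q j)) sums (x - of_int \<lfloor>x\<rfloor>)"

text \<open>
  The condition \<open>E 0 = 0\<close> only pins down the meaningless value at \<open>0\<close>, so that the
  expansion is unique as a function; see \<open>cantor_expansion_ex1\<close> below.
\<close>

definition cantor_digits :: "(nat \<Rightarrow> nat) \<Rightarrow> real \<Rightarrow> nat \<Rightarrow> nat" where
  "cantor_digits Q x = (THE E. E 0 = 0 \<and> is_cantor_expansion Q x E)"

definition block_count :: "(nat \<Rightarrow> nat) \<Rightarrow> nat list \<Rightarrow> real \<Rightarrow> nat \<Rightarrow> nat" where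
  "block_count Q B x n =
     card {i. 1 \<le> i \<and> i \<le> n \<and> (\<forall>k<length B. cantor_digits Q x (i + k) = B ! k)}"

text \<open>
  Since \<open>a / 0 = 0\<close>, the limit below can only be \<open>1\<close> if the denominator is eventually
  nonzero, i.e. if the quotients are eventually defined in the usual sense.
\<close>

definition simply_ratio_normal :: "(nat \<Rightarrow> nat) \<Rightarrow> real set" where
  "simply_ratio_normal Q = {x. \<forall>B1 B2. length B1 = 1 \<and> length B2 = 1 \<longrightarrow>
     (\<lambda>n. real (block_count Q B1 x n) / real (block_count Q B2 x n)) \<longlonglongrightarrow> 1}"

definition uniformly_distributed_mod1 :: "(nat \<Rightarrow> real) \<Rightarrow> bool" where
  "uniformly_distributed_mod1 y \<longleftrightarrow>
     (\<forall>a b. 0 \<le> a \<and> a < b \<and> b \<le> 1 \<longrightarrow>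
        (\<lambda>N. real (card {n. n < N \<and> frac (y n) \<in> {a..<b}}) / real N) \<longlonglongrightarrow> b - a)"

definition cantor_shift :: "(nat \<Rightarrow> nat) \<Rightarrow> nat \<Rightarrow> real \<Rightarrow> real" where
  "cantor_shift Q n x = frac (real (\<Prod>j=1..n. Q j) * x)"

definition distribution_normal :: "(nat \<Rightarrow> nat) \<Rightarrow> real set" where
  "distribution_normal Q = {x. uniformly_distributed_mod1 (\<lambda>n. cantor_shift Q n x)}"

definition block_product_rel :: "nat \<Rightarrow> (nat \<Rightarrow> nat) \<Rightarrow> (nat \<Rightarrow> nat) \<Rightarrow> bool" where
  "block_product_rel s P Q \<longleftrightarrow> (\<forall>n\<ge>1. Q n = (\<Prod>j=1..s. P (s * (n - 1) + j)))"

text \<open>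
  Hausdorff measures and dimension. The gauge \<open>(diam U)\<^sup>s\<close> uses the usual conventions
  that the empty set contributes \<open>0\<close> and that \<open>0\<^sup>0 = 1\<close> for nonempty sets (whereas
  \<open>0 powr 0 = 0\<close>). Covering sets are required to be bounded because \<open>diameter\<close> is
  unspecified on unbounded sets; finite covers are included by padding with the empty set.
\<close>

definition hausdorff_gauge :: "real \<Rightarrow> 'a::metric_space set \<Rightarrow> ennreal" where
  "hausdorff_gauge s U =
     (if U = {} then 0 else if s = 0 then 1 else ennreal (diameter U powr s))"

definition hausdorff_premeasure :: "real \<Rightarrow> real \<Rightarrow> 'a::metric_space set \<Rightarrow> ennreal" where
  "hausdorff_premeasure s \<delta> A =
     (INF U \<in> {U :: nat \<Rightarrow> 'a set. A \<subseteq> (\<Union>i. U i) \<and> (\<forall>i. bounded (U i) \<and> diameter (U i) \<le> \<delta>)}.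
        \<Sum>i. hausdorff_gauge s (U i))"

definition hausdorff_measure :: "real \<Rightarrow> 'a::metric_space set \<Rightarrow> ennreal" where
  "hausdorff_measure s A = (SUP \<delta> \<in> {0<..}. hausdorff_premeasure s \<delta> A)"

definition hausdorff_dim :: "'a::metric_space set \<Rightarrow> ennreal" where
  "hausdorff_dim A = Inf {ennreal s | s. 0 \<le> s \<and> hausdorff_measure s A = 0}"


lemma basic_prod_pos:
  assumes "basic_sequence Q"
  shows "(\<Prod>j=1..n. Q j) \<ge> 2 ^ n"
proof (induction n)
  case (Suc n)
  have "Q (Suc n) \<ge> 2" using assms by (simp add: basic_sequence_def)
  then have "2 ^ n * 2 \<le> (\<Prod>j=1..n. Q j) * Q (Suc n)" using Suc by (intro mult_le_mono)
  then show ?case by (simp add: mult.commute)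
qed simp

lemma cantor_expansion_exists:
  assumes Q: "basic_sequence Q"
  shows "\<exists>E. E 0 = 0 \<and> is_cantor_expansion Q x E"
proof -
  define a where "a n = real (\<Prod>j=1..n. Q j)" for n
  define t where "t n = frac (a n * x)" for n
  define E where "E n = (if n = 0 then 0 else nat \<lfloor>real (Q n) * t (n - 1)\<rfloor>)" for n
  have Q2: "Q (Suc n) \<ge> 2" for n using Q by (simp add: basic_sequence_def)
  have a_Suc: "a (Suc n) = a n * real (Q (Suc n))" for n by (simp add: a_def)
  have a_ge: "a n \<ge> 2 ^ n" for n
    using basic_prod_pos[OF Q, of n] unfolding a_def
    by (metis of_nat_le_iff of_nat_numeral of_nat_power)
  then have a_pos: "a n > 0" for n by (rule less_le_trans[rotated]) simp
  have t01: "0 \<le> t n" "t n < 1" for n by (simp_all add: t_def frac_lt_1)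
  have tS: "t (Suc n) = frac (real (Q (Suc n)) * t n)" for n
  proof -
    have "a (Suc n) * x = real (Q (Suc n)) * t n + of_int (int (Q (Suc n)) * \<lfloor>a n * x\<rfloor>)"
      by (simp add: a_Suc t_def frac_def algebra_simps)
    then show ?thesis unfolding t_def[of "Suc n"] frac_def by (simp add: floor_add_int [symmetric])
  qed
  have rec: "real (Q (Suc n)) * t n = real (E (Suc n)) + t (Suc n)" for n
  proof -
    have "0 \<le> \<lfloor>real (Q (Suc n)) * t n\<rfloor>" using t01 by simp
    then show ?thesis by (simp add: E_def tS frac_def)
  qed
  have Elt: "E (Suc n) < Q (Suc n)" for n
  proof -
    have "real (E (Suc n)) \<le> real (Q (Suc n)) * t n" using rec[of n] t01[of "Suc n"] by simp
    also have "\<dots> < real (Q (Suc n)) * 1" using t01[of n] Q2[of n] by (intro mult_strict_left_mono) auto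
    finally show ?thesis by simp
  qed
  have part: "(\<Sum>k<n. real (E (Suc k)) / a (Suc k)) = (x - of_int \<lfloor>x\<rfloor>) - t n / a n" for n
  proof (induction n)
    case 0 then show ?case by (simp add: t_def a_def frac_def)
  next
    case (Suc n)
    have "t n / a n = real (Q (Suc n)) * t n / a (Suc n)"
      using a_pos[of n] Q2[of n] by (simp add: a_Suc)
    also have "\<dots> = real (E (Suc n)) / a (Suc n) + t (Suc n) / a (Suc n)"
      by (simp add: rec add_divide_distrib)
    finally show ?case using Suc by simp
  qed
  have "(\<lambda>n. t n / a n) \<longlonglongrightarrow> 0"
  proof (rule tendsto_sandwich[OF _ _ tendsto_const])
    show "\<forall>\<^sub>F n in sequentially. 0 \<le> t n / a n"
      using t01 a_pos by (intro always_eventually allI divide_nonneg_pos)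
    show "\<forall>\<^sub>F n in sequentially. t n / a n \<le> (1/2) ^ n"
    proof (intro always_eventually allI)
      fix n
      have "t n / a n \<le> 1 / 2 ^ n"
        using t01[of n] a_ge[of n] by (intro frac_le) auto
      then show "t n / a n \<le> (1/2) ^ n" by (simp add: power_divide)
    qed
    show "(\<lambda>n. (1/2::real) ^ n) \<longlonglongrightarrow> 0" by (rule LIMSEQ_power_zero) simp
  qed
  then have "(\<lambda>n. (x - of_int \<lfloor>x\<rfloor>) - t n / a n) \<longlonglongrightarrow> (x - of_int \<lfloor>x\<rfloor>) - 0"
    by (intro tendsto_diff tendsto_const)
  then have sums: "(\<lambda>n. real (E (Suc n)) / a (Suc n)) sums (x - of_int \<lfloor>x\<rfloor>)"
    by (simp add: sums_def part)
  have inf: "infinite {n. n \<ge> 1 \<and> E n \<noteq> Q n - 1}"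
  proof
    assume "finite {n. n \<ge> 1 \<and> E n \<noteq> Q n - 1}"
    then obtain M where M: "\<And>n. n \<ge> 1 \<Longrightarrow> E n \<noteq> Q n - 1 \<Longrightarrow> n \<le> M"
      by (auto simp: finite_nat_set_iff_bounded_le)
    have step: "1 - t (Suc n) \<ge> 2 * (1 - t n)" if "n \<ge> M" for n
    proof -
      have "E (Suc n) = Q (Suc n) - 1" using M[of "Suc n"] that by force
      then have "real (E (Suc n)) = real (Q (Suc n)) - 1" using Q2[of n] by simp
      with rec[of n] have "1 - t (Suc n) = real (Q (Suc n)) * (1 - t n)"
        by (simp add: algebra_simps)
      moreover have "2 * (1 - t n) \<le> real (Q (Suc n)) * (1 - t n)"
        using t01[of n] Q2[of n] by (intro mult_right_mono) auto
      ultimately show ?thesis by simp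
    qed
    have grow: "1 - t (M + k) \<ge> 2 ^ k * (1 - t M)" for k
    proof (induction k)
      case (Suc k) then show ?case using step[of "M + k"] by simp
    qed simp
    obtain k where "1 / (1 - t M) < 2 ^ k"
      using real_arch_pow[of 2 "1 / (1 - t M)"] by auto
    then have "1 < 2 ^ k * (1 - t M)" using t01[of M] by (simp add: divide_less_eq)
    then show False using grow[of k] t01[of "M + k"] by simp
  qed
  have "E n \<in> {0..Q n - 1}" if "n \<ge> 1" for n
    using that Elt[of "n - 1"] by simp
  then have "is_cantor_expansion Q x E"
    using inf sums unfolding is_cantor_expansion_def a_def by blast
  moreover have "E 0 = 0" by (simp add: E_def)
  ultimately show ?thesis by blast
qed

text \<open>
  If two expansions first differ at position \<open>m + 1\<close>, with \<open>E (m + 1) < F (m + 1)\<close>, the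
  partial sums of \<open>E\<close> stay below those of \<open>F\<close> by a gap that is eventually bounded away
  from \<open>0\<close>.
\<close>

lemma cantor_expansion_unique_aux:
  assumes Q: "basic_sequence Q"
    and E: "is_cantor_expansion Q x E" and F: "is_cantor_expansion Q x F"
    and eq: "\<And>k. k < m \<Longrightarrow> E (Suc k) = F (Suc k)"
  shows "\<not> E (Suc m) < F (Suc m)"
proof
  assume lt: "E (Suc m) < F (Suc m)"
  define a where "a n = real (\<Prod>j=1..n. Q j)" for n
  have Q2: "Q (Suc n) \<ge> 2" for n using Q by (simp add: basic_sequence_def)
  have a_Suc: "a (Suc n) = a n * real (Q (Suc n))" for n by (simp add: a_def)
  have a_pos: "a n > 0" for n
    using basic_prod_pos[OF Q, of n] unfolding a_def
    by (metis of_nat_0_less_iff less_le_trans zero_less_numeral zero_less_power)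
  define e where "e n = real (E (Suc n)) / a (Suc n)" for n
  define f where "f n = real (F (Suc n)) / a (Suc n)" for n
  define d where "d n = (\<Sum>k<n. f k - e k)" for n
  have lim: "d \<longlonglongrightarrow> 0"
  proof -
    have "e sums (x - of_int \<lfloor>x\<rfloor>)" "f sums (x - of_int \<lfloor>x\<rfloor>)"
      using E F unfolding is_cantor_expansion_def e_def f_def a_def by auto
    from sums_diff[OF this(2,1)] show ?thesis by (simp add: sums_def d_def[abs_def])
  qed
  define g where "g n = d n - 1 / a n" for n
  have Ele: "real (E (Suc n)) \<le> real (Q (Suc n)) - 1" for n
  proof -
    have "E (Suc n) \<le> Q (Suc n) - 1" using E by (auto simp: is_cantor_expansion_def)
    then show ?thesis using Q2[of n] by linarith
  qed
  have gstep: "g (Suc n) - g n = (real (F (Suc n)) + (real (Q (Suc n)) - 1 - real (E (Suc n)))) / a (Suc n)" for n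
  proof -
    have "1 / a n = real (Q (Suc n)) / a (Suc n)" using a_pos[of n] Q2[of n] by (simp add: a_Suc)
    then show ?thesis
      by (simp add: g_def d_def e_def f_def diff_divide_distrib add_divide_distrib)
  qed
  have ginc: "incseq g"
  proof (rule incseq_SucI)
    fix n
    have "g (Suc n) - g n \<ge> 0" unfolding gstep
      using Ele[of n] a_pos[of "Suc n"] by (intro divide_nonneg_pos) auto
    then show "g n \<le> g (Suc n)" by simp
  qed
  have "d m = 0" using eq by (simp add: d_def e_def f_def)
  then have "d (Suc m) = (real (F (Suc m)) - real (E (Suc m))) / a (Suc m)"
    by (simp add: d_def e_def f_def diff_divide_distrib)
  moreover have "\<dots> \<ge> 1 / a (Suc m)" using lt a_pos[of "Suc m"] by (intro divide_right_mono) auto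
  ultimately have g0: "g (Suc m) \<ge> 0" by (simp add: g_def)
  have "infinite {n. n \<ge> 1 \<and> E n \<noteq> Q n - 1}" using E by (simp add: is_cantor_expansion_def)
  then obtain p where p: "p > Suc m" "E p \<noteq> Q p - 1"
    by (auto simp: infinite_nat_iff_unbounded)
  obtain n where n: "p = Suc n" using p by (cases p) auto
  have "real (E (Suc n)) \<noteq> real (Q (Suc n)) - 1"
    using p(2) Q2[of n] unfolding n by (auto simp: of_nat_diff)
  with Ele[of n] have "real (E (Suc n)) < real (Q (Suc n)) - 1" by simp
  then have "g (Suc n) - g n > 0" unfolding gstep
    using a_pos[of "Suc n"] by (intro divide_pos_pos) auto
  moreover have "g n \<ge> g (Suc m)" using incseqD[OF ginc, of "Suc m" n] p(1) n by simp
  ultimately have gpos: "g (Suc n) > 0" using g0 by simp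
  have "d k \<ge> g (Suc n)" if "k \<ge> Suc n" for k
    using incseqD[OF ginc that] a_pos[of k] unfolding g_def[of k]
    by (smt (verit) divide_nonneg_pos)
  then have "0 \<ge> g (Suc n)" using lim by (intro LIMSEQ_le_const[OF lim]) blast
  with gpos show False by simp
qed

lemma cantor_expansion_ex1:
  assumes "basic_sequence Q"
  shows "\<exists>!E. E 0 = 0 \<and> is_cantor_expansion Q x E"
proof (rule ex_ex1I)
  show "\<exists>E. E 0 = 0 \<and> is_cantor_expansion Q x E"
    by (rule cantor_expansion_exists[OF assms])
next
  fix E F
  assume E: "E 0 = 0 \<and> is_cantor_expansion Q x E" and F: "F 0 = 0 \<and> is_cantor_expansion Q x F"
  have "E (Suc m) = F (Suc m)" for m
  proof (induction m rule: less_induct)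
    case (less m)
    have "\<not> E (Suc m) < F (Suc m)" "\<not> F (Suc m) < E (Suc m)"
      using cantor_expansion_unique_aux[OF assms, of x E F m]
        cantor_expansion_unique_aux[OF assms, of x F E m] E F less by auto
    then show ?case by simp
  qed
  then show "E = F" using E F by (metis ext not0_implies_Suc)
qed

end

theory Submission
  imports Defs "HOL-Probability.Probability" "HOL-Library.Discrete_Functions"
begin

text \<open>
  Choose the digits of \<open>x\<close> in base \<open>Q\<close> independently, the \<open>n\<close>-th one uniformly in \<open>{c..<Q n}\<close> with
  \<open>c \<in> {0, 1}\<close>. Since \<open>Q\<close> is infinite in limit, the shift \<open>T\<^sub>n x\<close> is asymptotically the ratio of the
  digit \<open>n + 1\<close> to \<open>Q (n + 1)\<close>, so a second moment law of large numbers shows that almost surely all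
  sequences \<open>T\<^sub>n\<^sub>D x\<close> are uniformly distributed. As \<open>Q n / (Q n - c) \<le> Q n powr \<epsilon>\<close> eventually, the law of
  \<open>x\<close> is Hoelder continuous of every exponent \<open>s < 1\<close>, and the mass distribution principle gives
  dimension 1 to every set of full probability.

  In the convergent case take \<open>c = 0\<close>. The law of \<open>x\<close> is then uniform on the unit interval,
  independently of \<open>Q\<close>, so all \<open>Q\<^sub>j\<close> can be treated at once; almost surely
  some digit never occurs, which excludes ratio normality. In the chain case take \<open>c = 1\<close> and \<open>Q = Q\<^sub>1\<close>:
  the digit 0 never occurs in base \<open>Q\<^sub>1\<close>, hence in no base \<open>Q\<^sub>j\<close>, and the shifts for \<open>Q\<^sub>j\<close> are the shifts
  \<open>T\<^sub>n\<^sub>D\<close> for \<open>Q\<^sub>1\<close>.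
\<close>

section \<open>Cantor series expansions\<close>

definition base_prod :: "(nat \<Rightarrow> nat) \<Rightarrow> nat \<Rightarrow> nat" where
  "base_prod Q n = (\<Prod>j=1..n. Q j)"

lemma base_prod_0 [simp]: "base_prod Q 0 = 1"
  by (simp add: base_prod_def)

lemma base_prod_Suc [simp]: "base_prod Q (Suc n) = base_prod Q n * Q (Suc n)"
  by (simp add: base_prod_def)

lemma base_prod_pos: "basic_sequence Q \<Longrightarrow> base_prod Q n > 0"
  unfolding base_prod_def by (rule less_le_trans[OF _ basic_prod_pos]) simp_all

lemma two_power_le_base_prod:
  assumes "basic_sequence Q"
  shows "2 ^ n \<le> real (base_prod Q n)"
proof -
  have "2 ^ n \<le> base_prod Q n" unfolding base_prod_def by (rule basic_prod_pos[OF assms])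
  then have "real (2 ^ n) \<le> real (base_prod Q n)" by (rule of_nat_mono)
  then show ?thesis by simp
qed

lemma inverse_base_prod_tendsto_0:
  assumes "basic_sequence Q"
  shows "(\<lambda>n. 1 / real (base_prod Q n)) \<longlonglongrightarrow> 0"
proof (rule tendsto_sandwich[OF _ _ tendsto_const])
  show "\<forall>\<^sub>F n in sequentially. 1 / real (base_prod Q n) \<le> (1/2) ^ n"
  proof (intro always_eventually allI)
    fix n
    have "1 / real (base_prod Q n) \<le> 1 / 2 ^ n"
      using two_power_le_base_prod[OF assms, of n] by (intro frac_le) auto
    then show "1 / real (base_prod Q n) \<le> (1/2) ^ n" by (simp add: power_divide)
  qed
  show "(\<lambda>n. (1/2::real) ^ n) \<longlonglongrightarrow> 0" by (rule LIMSEQ_power_zero) simp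
  show "\<forall>\<^sub>F n in sequentially. 0 \<le> 1 / real (base_prod Q n)"
    by (intro always_eventually allI divide_nonneg_nonneg) auto
qed

text \<open>Horner scheme for the integer numerator of the \<open>n\<close>-th partial sum over
  \<open>base_prod Q n\<close>. As an integer it can be counted in intervals and decoded into
  digits.\<close>

primrec cantor_prefix :: "(nat \<Rightarrow> nat) \<Rightarrow> (nat \<Rightarrow> nat) \<Rightarrow> nat \<Rightarrow> nat" where
  "cantor_prefix Q E 0 = 0"
| "cantor_prefix Q E (Suc n) = cantor_prefix Q E n * Q (Suc n) + E (Suc n)"

definition cantor_value :: "(nat \<Rightarrow> nat) \<Rightarrow> (nat \<Rightarrow> nat) \<Rightarrow> real" where
  "cantor_value Q E = (\<Sum>n. real (E (Suc n)) / real (base_prod Q (Suc n)))"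

lemma sum_cantor_prefix:
  assumes "basic_sequence Q"
  shows "(\<Sum>k<n. real (E (Suc k)) / real (base_prod Q (Suc k))) =
           real (cantor_prefix Q E n) / real (base_prod Q n)"
proof (induction n)
  case (Suc n)
  have "Q (Suc n) > 0" using assms by (auto simp: basic_sequence_def intro: less_le_trans[of 0 2])
  then have "real (cantor_prefix Q E n) / real (base_prod Q n) =
      real (cantor_prefix Q E n * Q (Suc n)) / real (base_prod Q (Suc n))"
    unfolding base_prod_Suc of_nat_mult by (intro mult_divide_mult_cancel_right[symmetric]) simp
  then show ?case by (simp only: sum.lessThan_Suc Suc cantor_prefix.simps of_nat_add add_divide_distrib)
qed simp

text \<open>The quotient is the right end point of the interval of values with the given first
  digits. The next digit is at most \<open>Q (Suc n) - 1\<close>, so refining the interval cannot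
  move this end point up.\<close>

lemma cantor_prefix_upper_antimono:
  assumes Q: "basic_sequence Q" and E: "\<And>n. n \<ge> 1 \<Longrightarrow> E n < Q n" and "m \<le> n"
  shows "(real (cantor_prefix Q E n) + 1) / real (base_prod Q n) \<le>
         (real (cantor_prefix Q E m) + 1) / real (base_prod Q m)"
  using \<open>m \<le> n\<close>
proof (induction n rule: dec_induct)
  case (step n)
  have pos: "Q (Suc n) > 0" using E[of "Suc n"] by simp
  have "real (cantor_prefix Q E (Suc n)) + 1 \<le> (real (cantor_prefix Q E n) + 1) * real (Q (Suc n))"
    using E[of "Suc n"] by (simp add: algebra_simps)
  then have "(real (cantor_prefix Q E (Suc n)) + 1) / real (base_prod Q (Suc n)) \<le>
     (real (cantor_prefix Q E n) + 1) * real (Q (Suc n)) / real (base_prod Q (Suc n))"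
    by (intro divide_right_mono) auto
  also have "\<dots> = (real (cantor_prefix Q E n) + 1) / real (base_prod Q n)"
    unfolding base_prod_Suc of_nat_mult using pos by (intro mult_divide_mult_cancel_right) simp
  finally show ?case using step.IH by linarith
qed simp

lemma cantor_digits_sums:
  assumes Q: "basic_sequence Q" and E: "\<And>n. n \<ge> 1 \<Longrightarrow> E n < Q n"
  shows "(\<lambda>n. real (E (Suc n)) / real (base_prod Q (Suc n))) sums cantor_value Q E"
proof -
  have "summable (\<lambda>n. real (E (Suc n)) / real (base_prod Q (Suc n)))"
  proof (rule summableI_nonneg_bounded)
    fix n
    have "real (cantor_prefix Q E n) / real (base_prod Q n) \<le>
        (real (cantor_prefix Q E n) + 1) / real (base_prod Q n)"
      by (intro divide_right_mono) auto
    also have "\<dots> \<le> 1" using cantor_prefix_upper_antimono[OF Q E, of 0 n] by simp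
    finally show "(\<Sum>k<n. real (E (Suc k)) / real (base_prod Q (Suc k))) \<le> 1"
      unfolding sum_cantor_prefix[OF Q] .
  qed (auto intro!: divide_nonneg_nonneg)
  then show ?thesis by (simp add: cantor_value_def summable_sums)
qed

lemma cantor_prefix_tendsto:
  assumes Q: "basic_sequence Q" and E: "\<And>n. n \<ge> 1 \<Longrightarrow> E n < Q n"
  shows "(\<lambda>n. real (cantor_prefix Q E n) / real (base_prod Q n)) \<longlonglongrightarrow> cantor_value Q E"
  using cantor_digits_sums[OF assms] unfolding sums_def sum_cantor_prefix[OF Q] .

text \<open>Partial sums increase to the value from below. The right end points never increase, and
  they tend to the value as well, since they exceed the partial sums by
  \<open>1 / base_prod Q n\<close>.\<close>

lemma cantor_value_bounds:
  assumes Q: "basic_sequence Q" and E: "\<And>n. n \<ge> 1 \<Longrightarrow> E n < Q n"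
  shows "real (cantor_prefix Q E n) \<le> real (base_prod Q n) * cantor_value Q E"
    and "real (base_prod Q n) * cantor_value Q E \<le> real (cantor_prefix Q E n) + 1"
proof -
  have pos: "real (base_prod Q n) > 0" using base_prod_pos[OF Q] by simp
  note sums = cantor_digits_sums[OF assms]
  have "(\<Sum>k<n. real (E (Suc k)) / real (base_prod Q (Suc k))) \<le> cantor_value Q E"
    using sums_summable[OF sums] sums_unique[OF sums]
    by (metis (no_types, lifting) divide_nonneg_nonneg of_nat_0_le_iff sum_le_suminf finite_lessThan)
  then show "real (cantor_prefix Q E n) \<le> real (base_prod Q n) * cantor_value Q E"
    unfolding sum_cantor_prefix[OF Q] using pos by (simp add: divide_le_eq mult.commute)
  have "(\<lambda>k. real (cantor_prefix Q E k) / real (base_prod Q k) + 1 / real (base_prod Q k))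
          \<longlonglongrightarrow> cantor_value Q E + 0"
    by (intro tendsto_add cantor_prefix_tendsto inverse_base_prod_tendsto_0 assms)
  then have "cantor_value Q E + 0 \<le> (real (cantor_prefix Q E n) + 1) / real (base_prod Q n)"
    using cantor_prefix_upper_antimono[OF Q E, of n]
    by (intro LIMSEQ_le_const2) (auto simp: add_divide_distrib[symmetric])
  then show "real (base_prod Q n) * cantor_value Q E \<le> real (cantor_prefix Q E n) + 1"
    using pos by (simp add: le_divide_eq mult.commute)
qed

text \<open>A non-maximal digit beyond place \<open>n\<close> moves the right end point strictly
  down, which excludes equality.\<close>

lemma cantor_value_strict_upper:
  assumes Q: "basic_sequence Q" and E: "\<And>n. n \<ge> 1 \<Longrightarrow> E n < Q n"
    and inf: "infinite {n. n \<ge> 1 \<and> E n \<noteq> Q n - 1}"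
  shows "real (base_prod Q n) * cantor_value Q E < real (cantor_prefix Q E n) + 1"
proof -
  obtain p where p: "p > n" "E p \<noteq> Q p - 1"
    using inf by (auto simp: infinite_nat_iff_unbounded)
  obtain m where m: "p = Suc m" using p by (cases p) auto
  have "real (E (Suc m)) + 1 < real (Q (Suc m))" using E[of "Suc m"] p(2) m by simp
  then have lt: "real (cantor_prefix Q E (Suc m)) + 1 < (real (cantor_prefix Q E m) + 1) * real (Q (Suc m))"
    by (simp add: algebra_simps)
  have pos: "real (base_prod Q k) > 0" for k using base_prod_pos[OF Q] by simp
  have "cantor_value Q E \<le> (real (cantor_prefix Q E (Suc m)) + 1) / real (base_prod Q (Suc m))"
    using cantor_value_bounds(2)[OF Q E, of "Suc m"] pos[of "Suc m"]
    by (simp only: le_divide_eq mult.commute) (simp only: if_True)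
  also have "\<dots> < (real (cantor_prefix Q E m) + 1) * real (Q (Suc m)) / real (base_prod Q (Suc m))"
    using lt pos[of "Suc m"] by (rule divide_strict_right_mono)
  also have "\<dots> = (real (cantor_prefix Q E m) + 1) / real (base_prod Q m)"
    unfolding base_prod_Suc of_nat_mult using E[of "Suc m"]
    by (intro mult_divide_mult_cancel_right) simp
  also have "\<dots> \<le> (real (cantor_prefix Q E n) + 1) / real (base_prod Q n)"
    using p m by (intro cantor_prefix_upper_antimono[OF Q E]) auto
  finally show ?thesis using pos[of n] by (simp add: less_divide_eq mult.commute)
qed

lemma is_cantor_expansion_lt:
  assumes "basic_sequence Q" "is_cantor_expansion Q x E" "n \<ge> 1"
  shows "E n < Q n"
proof -
  have "E n \<le> Q n - 1" "Q n \<ge> 2" using assms by (auto simp: is_cantor_expansion_def basic_sequence_def)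
  then show ?thesis by simp
qed

text \<open>The claimed value differs from \<open>base_prod Q n * x\<close> by an integer and lies
  in the half-open unit interval, so it is the fractional part. Non-maximality of infinitely many
  digits enters through the strict upper bound.\<close>

lemma cantor_shift_expansion:
  assumes Q: "basic_sequence Q" and E: "is_cantor_expansion Q x E"
  shows "cantor_shift Q n x = real (base_prod Q n) * frac x - real (cantor_prefix Q E n)"
proof -
  note lt = is_cantor_expansion_lt[OF Q E]
  have v: "frac x = cantor_value Q E"
    using E sums_unique2[OF _ cantor_digits_sums[OF Q lt]]
    by (simp add: is_cantor_expansion_def frac_def base_prod_def)
  let ?r = "real (base_prod Q n) * frac x - real (cantor_prefix Q E n)"
  have "real (base_prod Q n) * x - ?r = of_int (int (base_prod Q n) * \<lfloor>x\<rfloor> + int (cantor_prefix Q E n))"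
    by (simp add: frac_def algebra_simps)
  then have "real (base_prod Q n) * x - ?r \<in> \<int>" by (metis Ints_of_int)
  moreover have "0 \<le> ?r" "?r < 1"
    using cantor_value_bounds(1)[OF Q lt, of n] cantor_value_strict_upper[OF Q lt, of n] E
    by (simp_all add: v is_cantor_expansion_def)
  ultimately show ?thesis unfolding cantor_shift_def base_prod_def[symmetric] by (simp add: frac_unique_iff)
qed

lemma cantor_shift_Suc:
  assumes Q: "basic_sequence Q" and E: "is_cantor_expansion Q x E"
  shows "real (Q (Suc n)) * cantor_shift Q n x = real (E (Suc n)) + cantor_shift Q (Suc n) x"
  unfolding cantor_shift_expansion[OF assms] by (simp add: algebra_simps)

lemma cantor_shift_bounds: "0 \<le> cantor_shift Q n x" "cantor_shift Q n x < 1"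
  by (simp_all add: cantor_shift_def frac_lt_1)

lemma cantor_digits_eq:
  assumes Q: "basic_sequence Q" and E: "is_cantor_expansion Q x E" and "n \<ge> 1"
  shows "cantor_digits Q x n = E n"
proof -
  \<comment> \<open>\<open>cantor_digits\<close> is normalised to \<open>0\<close> at place
    \<open>0\<close>, while \<open>E 0\<close> is arbitrary; resetting it leaves the expansion
    intact.\<close>
  have "is_cantor_expansion Q x (E(0 := 0))"
  proof -
    have "{n. n \<ge> 1 \<and> (E(0 := 0)) n \<noteq> Q n - 1} = {n. n \<ge> 1 \<and> E n \<noteq> Q n - 1}" by auto
    then show ?thesis using E unfolding is_cantor_expansion_def by simp
  qed
  then have "cantor_digits Q x = E(0 := 0)"
    unfolding cantor_digits_def by (intro the1_equality cantor_expansion_ex1 Q) simp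
  then show ?thesis using assms by simp
qed

lemma is_cantor_expansion_cantor_digits:
  assumes "basic_sequence Q"
  shows "is_cantor_expansion Q x (cantor_digits Q x)"
  unfolding cantor_digits_def using theI'[OF cantor_expansion_ex1[OF assms, of x]] by blast

text \<open>This closed form makes each digit a Borel function of \<open>x\<close> and lets a lower
  bound on the shift rule out the digit \<open>0\<close>.\<close>

lemma cantor_digits_Suc_floor:
  assumes "basic_sequence Q"
  shows "cantor_digits Q x (Suc n) = nat \<lfloor>real (Q (Suc n)) * cantor_shift Q n x\<rfloor>"
proof -
  have "\<lfloor>real (Q (Suc n)) * cantor_shift Q n x\<rfloor> = int (cantor_digits Q x (Suc n))"
    using cantor_shift_Suc[OF assms is_cantor_expansion_cantor_digits[OF assms], of n x]
      cantor_shift_bounds[of Q "Suc n" x] by (intro floor_unique) auto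
  then show ?thesis by simp
qed

lemma is_cantor_expansion_cantor_value:
  assumes Q: "basic_sequence Q" and E: "\<And>n. n \<ge> 1 \<Longrightarrow> E n < Q n"
    and inf: "infinite {n. n \<ge> 1 \<and> E n \<noteq> Q n - 1}"
  shows "is_cantor_expansion Q (cantor_value Q E) E"
proof -
  have "0 \<le> cantor_value Q E" "cantor_value Q E < 1"
    using cantor_value_bounds(1)[OF Q E, of 0] cantor_value_strict_upper[OF assms, of 0] by simp_all
  then have "\<lfloor>cantor_value Q E\<rfloor> = 0" by linarith
  moreover have "E n \<in> {0..Q n - 1}" if "n \<ge> 1" for n using E[OF that] by auto
  ultimately show ?thesis using inf cantor_digits_sums[OF Q E]
    unfolding is_cantor_expansion_def base_prod_def by auto
qed

text \<open>With both blocks equal to \<open>[i]\<close> the quotient is \<open>0 / 0\<close>, which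
  is \<open>0\<close> by convention for every \<open>n\<close> and so cannot tend to
  \<open>1\<close>.\<close>

lemma not_simply_ratio_normal_if_digit_missing:
  assumes "\<And>n. n \<ge> 1 \<Longrightarrow> cantor_digits Q x n \<noteq> i"
  shows "x \<notin> simply_ratio_normal Q"
proof
  assume "x \<in> simply_ratio_normal Q"
  then have "(\<lambda>n. real (block_count Q [i] x n) / real (block_count Q [i] x n)) \<longlonglongrightarrow> 1"
    unfolding simply_ratio_normal_def mem_Collect_eq by (elim allE[of _ "[i]"]) simp
  moreover have "block_count Q [i] x n = 0" for n
    using assms by (auto simp: block_count_def)
  ultimately show False by (simp add: LIMSEQ_const_iff)
qed

section \<open>A strong law for pairwise independent events\<close>

text \<open>Convergence of Cesaro means: the first \<open>K\<close> deviations contribute the fixed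
  amount \<open>C\<close>, the later ones stay below \<open>e / 2\<close>.\<close>

lemma average_tendsto:
  fixes f :: "nat \<Rightarrow> real"
  assumes "f \<longlonglongrightarrow> t"
  shows "(\<lambda>N. (\<Sum>n<N. f n) / real N) \<longlonglongrightarrow> t"
proof (rule LIMSEQ_I)
  fix e :: real assume "e > 0"
  then obtain K where K: "\<And>n. n \<ge> K \<Longrightarrow> \<bar>f n - t\<bar> < e / 2"
    using LIMSEQ_D[OF assms, of "e / 2"] by auto
  define C where "C = (\<Sum>n<K. \<bar>f n - t\<bar>)"
  obtain N0 :: nat where N0: "2 * C / e < real N0" using reals_Archimedean2 by blast
  have "norm ((\<Sum>n<N. f n) / real N - t) < e" if N: "N \<ge> max 1 (max K N0)" for N
  proof -
    have "\<bar>\<Sum>n<N. f n - t\<bar> \<le> (\<Sum>n<N. \<bar>f n - t\<bar>)" by (rule sum_abs)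
    also have "\<dots> = C + (\<Sum>n\<in>{K..<N}. \<bar>f n - t\<bar>)"
      unfolding C_def using N sum.atLeastLessThan_concat[of 0 K N "\<lambda>n. \<bar>f n - t\<bar>"]
      by (simp add: lessThan_atLeast0)
    also have "(\<Sum>n\<in>{K..<N}. \<bar>f n - t\<bar>) \<le> real (card {K..<N}) * (e / 2)"
      using K by (intro sum_bounded_above less_imp_le) auto
    also have "real (card {K..<N}) * (e / 2) \<le> real N * (e / 2)"
      using \<open>e > 0\<close> by (intro mult_right_mono) auto
    finally have "\<bar>\<Sum>n<N. f n - t\<bar> \<le> C + real N * (e / 2)" by simp
    moreover have "C < real N * (e / 2)"
    proof -
      have "2 * C / e < real N" using N0 N by linarith
      then show ?thesis using \<open>e > 0\<close> by (simp add: divide_less_eq)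
    qed
    ultimately have "\<bar>\<Sum>n<N. f n - t\<bar> < real N * e" by linarith
    moreover have "(\<Sum>n<N. f n) / real N - t = (\<Sum>n<N. f n - t) / real N"
      using N by (simp add: sum_subtractf field_simps)
    ultimately show ?thesis using N by (simp add: abs_divide divide_less_eq mult.commute)
  qed
  then show "\<exists>no. \<forall>n\<ge>no. norm ((\<Sum>n<n. f n) / real n - t) < e" by blast
qed

text \<open>Going from the largest square \<open>k^2\<close> not exceeding \<open>N\<close> up to
  \<open>N\<close> adds at most \<open>3 * k\<close> terms of size at most \<open>1\<close>, a
  contribution of order \<open>1 / k\<close> after division.\<close>

lemma average_tendsto_0_if_squares:
  fixes f :: "nat \<Rightarrow> real"
  assumes f: "\<And>n. \<bar>f n\<bar> \<le> 1"
    and lim: "(\<lambda>k. (\<Sum>n<k\<^sup>2. f n) / real (k\<^sup>2)) \<longlonglongrightarrow> 0"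
  shows "(\<lambda>N. (\<Sum>n<N. f n) / real N) \<longlonglongrightarrow> 0"
proof -
  have sqrt: "filterlim floor_sqrt at_top sequentially"
    unfolding filterlim_at_top eventually_sequentially
    by (metis le_floor_sqrt_iff)
  have "(\<lambda>k. \<bar>(\<Sum>n<k\<^sup>2. f n) / real (k\<^sup>2)\<bar> + 3 / real k) \<longlonglongrightarrow> 0"
    using tendsto_add[OF tendsto_rabs_zero[OF lim] lim_const_over_n[of 3]] by simp
  then have "(\<lambda>N. \<bar>(\<Sum>n<(floor_sqrt N)\<^sup>2. f n) / real ((floor_sqrt N)\<^sup>2)\<bar> + 3 / real (floor_sqrt N)) \<longlonglongrightarrow> 0"
    using sqrt by (rule filterlim_compose)
  moreover have "\<forall>\<^sub>F N in sequentially. norm ((\<Sum>n<N. f n) / real N) \<le>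
     \<bar>(\<Sum>n<(floor_sqrt N)\<^sup>2. f n) / real ((floor_sqrt N)\<^sup>2)\<bar> + 3 / real (floor_sqrt N)"
    using eventually_ge_at_top[of 1]
  proof eventually_elim
    case (elim N)
    define k where "k = floor_sqrt N"
    have k: "k \<ge> 1" using elim by (simp add: k_def le_floor_sqrt_iff)
    have k2: "k\<^sup>2 \<le> N" by (simp add: k_def)
    have "N < (Suc k)\<^sup>2" unfolding k_def by (rule Suc_floor_sqrt_power2_gt)
    then have gap: "N - k\<^sup>2 \<le> 3 * k" using k by (simp add: power2_eq_square)
    have "\<bar>\<Sum>n\<in>{k\<^sup>2..<N}. f n\<bar> \<le> (\<Sum>n\<in>{k\<^sup>2..<N}. \<bar>f n\<bar>)" by (rule sum_abs)
    also have "\<dots> \<le> real (card {k\<^sup>2..<N}) * 1" using f by (intro sum_bounded_above) auto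
    also have "\<dots> \<le> 3 * real k" using gap by simp
    finally have r: "\<bar>\<Sum>n\<in>{k\<^sup>2..<N}. f n\<bar> \<le> 3 * real k" .
    have "(\<Sum>n<N. f n) = (\<Sum>n<k\<^sup>2. f n) + (\<Sum>n\<in>{k\<^sup>2..<N}. f n)"
      using sum.atLeastLessThan_concat[of 0 "k\<^sup>2" N f] k2 by (simp add: lessThan_atLeast0)
    then have "\<bar>\<Sum>n<N. f n\<bar> \<le> \<bar>\<Sum>n<k\<^sup>2. f n\<bar> + 3 * real k" using r by linarith
    then have "\<bar>\<Sum>n<N. f n\<bar> / real N \<le> (\<bar>\<Sum>n<k\<^sup>2. f n\<bar> + 3 * real k) / real (k\<^sup>2)"
      using k k2 by (intro frac_le) (auto intro: of_nat_mono)
    also have "\<dots> = \<bar>(\<Sum>n<k\<^sup>2. f n) / real (k\<^sup>2)\<bar> + 3 / real k"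
      using k by (simp add: add_divide_distrib power2_eq_square)
    finally show ?case by (simp add: k_def)
  qed
  ultimately show ?thesis by (rule Lim_null_comparison[rotated])
qed

text \<open>Pairwise independence makes the centred indicators uncorrelated, so the second moment of
  \<open>S N\<close> is at most \<open>N\<close>. Along \<open>N = k^2\<close> the averages have
  second moments at most \<open>1 / k^2\<close>, which is summable; this gives almost sure
  convergence along squares, and boundedness extends it to all \<open>N\<close>.\<close>

lemma (in prob_space) strong_law_pairwise_indep_events:
  assumes A [measurable]: "\<And>n. A n \<in> events"
    and ind: "\<And>i j. i \<noteq> j \<Longrightarrow> prob (A i \<inter> A j) = prob (A i) * prob (A j)"
    and lim: "(\<lambda>n. prob (A n)) \<longlonglongrightarrow> t"
  shows "AE \<omega> in M. (\<lambda>N. real (card {n. n < N \<and> \<omega> \<in> A n}) / real N) \<longlonglongrightarrow> t"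
proof -
  define f where "f n \<omega> = indicat_real (A n) \<omega> - prob (A n)" for n \<omega>
  have [measurable]: "f n \<in> borel_measurable M" for n unfolding f_def by measurable
  have f1: "\<bar>f n \<omega>\<bar> \<le> 1" for n \<omega>
    using prob_le_1[of "A n"] measure_nonneg[of M "A n"]
    by (auto simp: f_def indicator_def)
  have int: "integrable M (\<lambda>\<omega>. f i \<omega> * f j \<omega>)" for i j
    by (rule integrable_const_bound[of _ 1]) (use f1 in \<open>auto simp: abs_mult intro!: mult_le_one\<close>)
  have cov: "expectation (\<lambda>\<omega>. f i \<omega> * f j \<omega>) \<le> (if i = j then 1 else 0)" for i j
  proof (cases "i = j")
    case True
    have "expectation (\<lambda>\<omega>. f i \<omega> * f j \<omega>) \<le> expectation (\<lambda>\<omega>. 1)"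
    proof (intro integral_mono int)
      fix \<omega>
      have "\<bar>f i \<omega> * f j \<omega>\<bar> \<le> 1" unfolding abs_mult by (intro mult_le_one f1) simp
      then show "f i \<omega> * f j \<omega> \<le> 1" by linarith
    qed simp
    then show ?thesis using True by (simp add: prob_space)
  next
    case False
    have integrable_event: "integrable M (indicat_real B)" if "B \<in> events" for B
      using that by (simp add: emeasure_eq_measure)
    have "f i \<omega> * f j \<omega> = indicat_real (A i \<inter> A j) \<omega> - prob (A j) * indicat_real (A i) \<omega>
        - prob (A i) * indicat_real (A j) \<omega> + prob (A i) * prob (A j)" for \<omega>
      by (simp add: f_def indicator_def algebra_simps)
    then have "expectation (\<lambda>\<omega>. f i \<omega> * f j \<omega>) = 0"
      using ind[OF False] by (simp add: integrable_event prob_space)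
    then show ?thesis using False by simp
  qed
  define S where "S N \<omega> = (\<Sum>n<N. f n \<omega>)" for N \<omega>
  have [measurable]: "S N \<in> borel_measurable M" for N unfolding S_def by measurable
  have SS: "(S N \<omega>)\<^sup>2 = (\<Sum>i<N. \<Sum>j<N. f i \<omega> * f j \<omega>)" for N \<omega>
    by (simp add: S_def power2_eq_square sum_product)
  have var: "expectation (\<lambda>\<omega>. (S N \<omega>)\<^sup>2) \<le> real N" for N
  proof -
    have "expectation (\<lambda>\<omega>. (S N \<omega>)\<^sup>2) = (\<Sum>i<N. \<Sum>j<N. expectation (\<lambda>\<omega>. f i \<omega> * f j \<omega>))"
      unfolding SS by (simp add: int)
    also have "\<dots> \<le> (\<Sum>i<N. \<Sum>j<N. if i = j then 1 else 0)" by (intro sum_mono cov)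
    finally show ?thesis by simp
  qed
  have intS: "integrable M (\<lambda>\<omega>. (S N \<omega>)\<^sup>2)" for N unfolding SS by (simp add: int)
  define Z where "Z k \<omega> = (S (k\<^sup>2) \<omega> / real (k\<^sup>2))\<^sup>2" for k \<omega>
  have [measurable]: "Z k \<in> borel_measurable M" for k unfolding Z_def by measurable
  \<comment> \<open>For \<open>k = 0\<close> both sides are \<open>0\<close>, because division by
    zero yields \<open>0\<close>.\<close>
  have Z: "(\<integral>\<^sup>+\<omega>. ennreal (Z k \<omega>) \<partial>M) \<le> ennreal (1 / real k ^ 2)" for k
  proof (cases "k = 0")
    case False
    have "(\<integral>\<^sup>+\<omega>. ennreal (Z k \<omega>) \<partial>M) = ennreal (expectation (Z k))"
      using intS[of "k\<^sup>2"] by (intro nn_integral_eq_integral) (auto simp: Z_def power_divide)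
    also have "expectation (Z k) = expectation (\<lambda>\<omega>. (S (k\<^sup>2) \<omega>)\<^sup>2) / (real (k\<^sup>2))\<^sup>2"
      by (simp add: Z_def[abs_def] power_divide)
    also have "\<dots> \<le> real (k\<^sup>2) / (real (k\<^sup>2))\<^sup>2" by (intro divide_right_mono var) simp
    also have "\<dots> = 1 / real k ^ 2" using False by (simp add: power2_eq_square)
    finally show ?thesis by (simp add: ennreal_leI)
  qed (simp add: Z_def)
  have "summable (\<lambda>k. 1 / real k ^ 2)"
    using inverse_power_summable[of 2, where 'a = real] by (simp add: inverse_eq_divide)
  then have "(\<Sum>k. ennreal (1 / real k ^ 2)) \<noteq> \<infinity>"
    by (simp add: ennreal_suminf_neq_top)
  then have "(\<integral>\<^sup>+\<omega>. (\<Sum>k. ennreal (Z k \<omega>)) \<partial>M) \<noteq> \<infinity>"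
    using suminf_le[of "\<lambda>k. \<integral>\<^sup>+\<omega>. ennreal (Z k \<omega>) \<partial>M" "\<lambda>k. ennreal (1 / real k ^ 2)"] Z
    by (subst nn_integral_suminf) (auto simp: top_unique)
  then have "AE \<omega> in M. (\<Sum>k. ennreal (Z k \<omega>)) \<noteq> \<infinity>"
    by (intro nn_integral_PInf_AE) auto
  then show ?thesis
  proof eventually_elim
    case (elim \<omega>)
    have "summable (\<lambda>k. Z k \<omega>)"
      using elim by (intro summable_suminf_not_top) (auto simp: Z_def)
    then have "(\<lambda>k. (S (k\<^sup>2) \<omega> / real (k\<^sup>2))\<^sup>2) \<longlonglongrightarrow> 0"
      unfolding Z_def by (rule summable_LIMSEQ_zero)
    then have "(\<lambda>k. S (k\<^sup>2) \<omega> / real (k\<^sup>2)) \<longlonglongrightarrow> 0"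
      by (auto dest!: tendsto_real_sqrt intro: tendsto_rabs_zero_cancel)
    then have "(\<lambda>N. (\<Sum>n<N. f n \<omega>) / real N) \<longlonglongrightarrow> 0"
      unfolding S_def by (intro average_tendsto_0_if_squares f1)
    from tendsto_add[OF this average_tendsto[OF lim]]
    have "(\<lambda>N. (\<Sum>n<N. indicat_real (A n) \<omega>) / real N) \<longlonglongrightarrow> t"
      by (simp add: f_def add_divide_distrib[symmetric] sum.distrib[symmetric])
    moreover have "(\<Sum>n<N. indicat_real (A n) \<omega>) = real (card {n. n < N \<and> \<omega> \<in> A n})" for N
    proof -
      have "(\<Sum>n<N. indicat_real (A n) \<omega>) = real (card {n \<in> {..<N}. \<omega> \<in> A n})"
        by (simp add: indicator_def sum.If_cases Int_def)
      then show ?thesis by simp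
    qed
    ultimately show ?case by simp
  qed
qed

section \<open>Hausdorff dimension on the real line\<close>

text \<open>Replaces an arbitrary covering set by an interval of the same diameter, to which a bound
  on interval masses applies.\<close>

lemma real_set_subset_interval_diameter:
  fixes U :: "real set"
  assumes "bounded U" "U \<noteq> {}"
  shows "U \<subseteq> {Inf U..Inf U + diameter U}"
proof
  fix x assume x: "x \<in> U"
  have "x - diameter U \<le> Inf U"
  proof (rule cInf_greatest[OF assms(2)])
    fix y assume "y \<in> U"
    then show "x - diameter U \<le> y"
      using diameter_bounded_bound[OF assms(1) x] by (force simp: dist_real_def)
  qed
  then show "x \<in> {Inf U..Inf U + diameter U}"
    using cInf_lower[OF x] bounded_imp_bdd_below[OF assms(1)] by auto
qed

text \<open>Each covering set is enclosed in a Borel set whose mass is at most \<open>K\<close>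
  times the gauge. Since a cover of \<open>A\<close> carries total mass \<open>1\<close>, its gauges
  sum to at least \<open>1 / K\<close>. Only the enclosing sets are measured, so neither
  \<open>A\<close> nor its covers have to be measurable.\<close>

lemma (in prob_space) mass_distribution_principle:
  fixes A :: "real set"
  assumes X [measurable]: "X \<in> borel_measurable M" and A: "AE \<omega> in M. X \<omega> \<in> A" and s: "0 \<le> s"
    and C: "\<And>u v. u < v \<Longrightarrow> v - u \<le> 1 \<Longrightarrow>
      prob {\<omega> \<in> space M. X \<omega> \<in> {u..v}} \<le> C * (v - u) powr s"
  shows "hausdorff_measure s A \<noteq> 0"
proof -
  \<comment> \<open>The maximum with \<open>1\<close> allows division by \<open>K\<close> and makes
    \<open>K\<close> a bound for the total mass, as required when \<open>s = 0\<close>.\<close>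
  define K where "K = max C 1"
  have K: "K > 0" "K \<ge> 1" "K \<ge> C" by (auto simp: K_def)
  have cover: "\<exists>B\<in>sets borel. U \<subseteq> B \<and> emeasure M {\<omega> \<in> space M. X \<omega> \<in> B} \<le> ennreal K * hausdorff_gauge s U"
    if U: "bounded U" "diameter U \<le> 1" for U :: "real set"
  proof (cases "U = {} \<or> s = 0")
    case True
    show ?thesis
    proof (cases "U = {}")
      case False
      then have "hausdorff_gauge s U = 1" using True by (simp add: hausdorff_gauge_def)
      moreover have "emeasure M {\<omega> \<in> space M. X \<omega> \<in> UNIV} \<le> ennreal K"
        using K by (simp add: emeasure_space_1)
      ultimately show ?thesis by (intro bexI[of _ UNIV]) auto
    qed (auto intro!: bexI[of _ "{}"])
  next
    case False
    define u d where "u = Inf U" and "d = diameter U"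
    have sub: "U \<subseteq> {u..u + d}"
      unfolding u_def d_def using False U by (intro real_set_subset_interval_diameter) auto
    have "d \<ge> 0" unfolding d_def by (rule diameter_ge_0[OF U(1)])
    have "prob {\<omega> \<in> space M. X \<omega> \<in> {u..u + d}} \<le> K * d powr s"
    proof (cases "d = 0")
      case False
      then have "prob {\<omega> \<in> space M. X \<omega> \<in> {u..u + d}} \<le> C * d powr s"
        using C[of u "u + d"] \<open>d \<ge> 0\<close> U(2) by (simp add: d_def)
      also have "\<dots> \<le> K * d powr s" using K by (intro mult_right_mono) auto
      finally show ?thesis .
    next
      case True
      \<comment> \<open>A single point has gauge \<open>0\<close> here, and the hypothesis speaks
        only of \<open>u < v\<close>; shrinking intervals show that the point has mass zero, as
        \<open>s > 0\<close>.\<close>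
      have "prob {\<omega> \<in> space M. X \<omega> \<in> {u..u + d}} \<le> C * (1 / real (Suc n)) powr s" for n
      proof -
        have "prob {\<omega> \<in> space M. X \<omega> \<in> {u..u + d}} \<le> prob {\<omega> \<in> space M. X \<omega> \<in> {u..u + 1 / real (Suc n)}}"
          using True by (intro finite_measure_mono) (auto intro: add_increasing2)
        also have "\<dots> \<le> C * (1 / real (Suc n)) powr s"
          using C[of u "u + 1 / real (Suc n)"] by simp
        finally show ?thesis .
      qed
      moreover have "(\<lambda>n. C * (1 / real (Suc n)) powr s) \<longlonglongrightarrow> C * 0"
        using False s LIMSEQ_Suc[OF lim_const_over_n[of 1]]
        by (intro tendsto_mult tendsto_const tendsto_zero_powrI[where b = s]) auto
      ultimately have "prob {\<omega> \<in> space M. X \<omega> \<in> {u..u + d}} \<le> C * 0"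
        by (intro LIMSEQ_le_const) auto
      then show ?thesis using K True by simp
    qed
    then have "emeasure M {\<omega> \<in> space M. X \<omega> \<in> {u..u + d}} \<le> ennreal K * ennreal (d powr s)"
      using K by (simp add: emeasure_eq_measure ennreal_mult[symmetric])
    then show ?thesis using False sub
      by (intro bexI[of _ "{u..u + d}"]) (auto simp: hausdorff_gauge_def d_def)
  qed
  have "ennreal (1 / K) \<le> hausdorff_premeasure s 1 A"
    unfolding hausdorff_premeasure_def
  proof (rule INF_greatest)
    fix U :: "nat \<Rightarrow> real set"
    assume "U \<in> {U. A \<subseteq> (\<Union>i. U i) \<and> (\<forall>i. bounded (U i) \<and> diameter (U i) \<le> 1)}"
    then have AU: "A \<subseteq> (\<Union>i. U i)" and "\<And>i. bounded (U i)" "\<And>i. diameter (U i) \<le> 1" by auto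
    then have "\<exists>B\<in>sets borel. U i \<subseteq> B \<and> emeasure M {\<omega> \<in> space M. X \<omega> \<in> B} \<le> ennreal K * hausdorff_gauge s (U i)" for i
      by (intro cover) auto
    then obtain B where [measurable]: "\<And>i. B i \<in> sets borel" and UB: "\<And>i. U i \<subseteq> B i"
      and le: "\<And>i. emeasure M {\<omega> \<in> space M. X \<omega> \<in> B i} \<le> ennreal K * hausdorff_gauge s (U i)"
      by metis
    have "1 = emeasure M {\<omega> \<in> space M. \<exists>i. X \<omega> \<in> B i}"
    proof (rule emeasure_eq_1_AE[symmetric])
      show "AE \<omega> in M. \<omega> \<in> {\<omega> \<in> space M. \<exists>i. X \<omega> \<in> B i}"
        using A AE_space by eventually_elim (use AU UB in blast)
    qed measurable
    also have "{\<omega> \<in> space M. \<exists>i. X \<omega> \<in> B i} = (\<Union>i. {\<omega> \<in> space M. X \<omega> \<in> B i})" by auto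
    also have "emeasure M \<dots> \<le> (\<Sum>i. emeasure M {\<omega> \<in> space M. X \<omega> \<in> B i})"
      by (rule emeasure_subadditive_countably) auto
    also have "\<dots> \<le> (\<Sum>i. ennreal K * hausdorff_gauge s (U i))"
      by (intro suminf_le le) auto
    finally have one: "1 \<le> ennreal K * (\<Sum>i. hausdorff_gauge s (U i))" by simp
    have "ennreal (1 / K) \<le> ennreal (1 / K) * (ennreal K * (\<Sum>i. hausdorff_gauge s (U i)))"
      using mult_left_mono[OF one, of "ennreal (1 / K)"] by simp
    also have "\<dots> = (\<Sum>i. hausdorff_gauge s (U i))"
      using K by (simp add: mult.assoc[symmetric] ennreal_mult[symmetric])
    finally show "ennreal (1 / K) \<le> (\<Sum>i. hausdorff_gauge s (U i))" .
  qed
  also have "\<dots> \<le> hausdorff_measure s A"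
    unfolding hausdorff_measure_def by (rule SUP_upper) simp
  finally have "ennreal (1 / K) \<le> hausdorff_measure s A" .
  moreover have "0 < ennreal (1 / K)" using K by simp
  ultimately show ?thesis by auto
qed

text \<open>By divergence of the harmonic series, consecutive intervals of lengths
  \<open>c / (k + 1)\<close> exhaust the half line.\<close>

lemma nonneg_real_in_harmonic_interval:
  fixes x c :: real
  assumes "0 \<le> x" "0 < c"
  shows "\<exists>k. c * harm k \<le> x \<and> x \<le> c * harm (Suc k)"
proof -
  have "\<exists>n. x < c * harm n"
  proof -
    obtain n :: nat where "harm n > x / c"
      using harm_at_top by (auto simp: filterlim_at_top_dense eventually_sequentially)
    then show ?thesis using assms by (auto simp: divide_less_eq mult.commute)
  qed
  define n where "n = (LEAST n. x < c * harm n)"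
  have n: "x < c * harm n" unfolding n_def by (rule LeastI_ex) fact
  then have "n \<noteq> 0" using assms by (intro notI) (simp add: harm_def)
  then obtain k where k: "n = Suc k" by (cases n) auto
  have "\<not> x < c * harm k" using not_less_Least[of k "\<lambda>n. x < c * harm n"] k unfolding n_def by simp
  then show ?thesis using n k by (intro exI[of _ k]) auto
qed

text \<open>One cover serves the whole line: intervals of lengths \<open>c / (k + 1)\<close> and
  their reflections. The lengths have a divergent sum, but for \<open>s > 1\<close> their powers sum
  to at most a constant times \<open>c powr s\<close>, which vanishes with \<open>c\<close>.\<close>

lemma hausdorff_measure_real_eq_0:
  fixes A :: "real set"
  assumes "s > 1"
  shows "hausdorff_measure s A = 0"
proof -
  have pre: "hausdorff_premeasure s \<delta> A \<le> ennreal e" if "\<delta> > 0" "e > 0" for \<delta> e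
  proof -
    \<comment> \<open>This is the value of the Riemann zeta function at \<open>s\<close>.\<close>
    define z where "z = (\<Sum>n. 1 / real (Suc n) powr s)"
    have summ: "summable (\<lambda>n. 1 / real (Suc n) powr s)"
      using assms summable_Suc_iff[of "\<lambda>n. real n powr - s"] summable_real_powr_iff[of "- s"]
      by (simp add: powr_minus_divide)
    have "z \<ge> 0" unfolding z_def by (intro suminf_nonneg summ) auto
    have "((\<lambda>c. (2 * c) powr s * z) \<longlongrightarrow> 0 * z) (at_right 0)"
      using assms by (intro tendsto_mult tendsto_const tendsto_zero_powrI[where b = s] tendsto_eq_intros)
        (auto simp: eventually_at_filter)
    then have "\<forall>\<^sub>F c in at_right 0. (2 * c) powr s * z < e"
      using \<open>e > 0\<close> by (intro order_tendstoD) auto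
    moreover have "\<forall>\<^sub>F c in at_right 0. c < \<delta>"
      using \<open>\<delta> > 0\<close> eventually_at_right_field by blast
    moreover have "\<forall>\<^sub>F c in at_right (0::real). c > 0" by (rule eventually_at_right_less)
    ultimately have "\<forall>\<^sub>F c in at_right 0. (2 * c) powr s * z < e \<and> c < \<delta> \<and> c > 0"
      by eventually_elim auto
    then obtain c where c: "(2 * c) powr s * z < e" "c < \<delta>" "c > 0"
      using eventually_happens'[OF trivial_limit_at_right_real] by blast
    define V where "V k = {c * harm k..c * harm (Suc k)}" for k
    \<comment> \<open>Even indices cover the nonnegative half line, odd indices its
      reflection.\<close>
    define U where "U n = (if even n then V (n div 2) else uminus ` V (n div 2))" for n
    have hS: "c * harm (Suc k) = c * harm k + c / real (Suc k)" for k
      by (simp add: harm_Suc inverse_eq_divide ring_distribs)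
    have hle: "0 \<le> c / real (Suc k)" for k using c by (intro divide_nonneg_pos) auto
    have dV: "diameter (V k) = c / real (Suc k)" for k
      using hle[of k] unfolding V_def hS by (simp add: diameter_closed_interval del: of_nat_Suc)
    have dU: "diameter (U n) = c / real (Suc (n div 2))" for n
    proof -
      have "uminus ` V (n div 2) = {- (c * harm (Suc (n div 2)))..- (c * harm (n div 2))}"
        by (simp add: V_def)
      then have "diameter (uminus ` V (n div 2)) = c / real (Suc (n div 2))"
        using hle[of "n div 2"] unfolding hS by (simp add: diameter_closed_interval del: of_nat_Suc)
      then show ?thesis by (simp add: U_def dV)
    qed
    have "bounded (U n)" for n by (simp add: U_def V_def)
    moreover have "diameter (U n) \<le> \<delta>" for n
    proof -
      have "c / real (Suc (n div 2)) \<le> c / 1" using c by (intro divide_left_mono) auto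
      then show ?thesis using c by (simp add: dU)
    qed
    moreover have "x \<in> (\<Union>n. U n)" for x
    proof (cases "x \<ge> 0")
      case True
      then obtain k where "x \<in> V k" using nonneg_real_in_harmonic_interval[of x c] c by (auto simp: V_def)
      then have "x \<in> U (2 * k)" by (simp add: U_def)
      then show ?thesis by blast
    next
      case False
      then obtain k where "- x \<in> V k" using nonneg_real_in_harmonic_interval[of "- x" c] c by (auto simp: V_def)
      then have "x \<in> uminus ` V k" by force
      then have "x \<in> U (2 * k + 1)" by (simp add: U_def)
      then show ?thesis by blast
    qed
    ultimately have "hausdorff_premeasure s \<delta> A \<le> (\<Sum>n. hausdorff_gauge s (U n))"
      unfolding hausdorff_premeasure_def by (intro INF_lower) auto
    also have "\<dots> \<le> (\<Sum>n. ennreal ((2 * c) powr s * (1 / real (Suc n) powr s)))"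
    proof (intro suminf_le)
      fix n
      \<comment> \<open>Each length occurs twice in the interleaved cover; the factor
        \<open>2\<close> allows a comparison with a series indexed by \<open>n\<close>
        itself.\<close>
      have "c / real (Suc (n div 2)) \<le> 2 * c / real (Suc n)"
      proof -
        have "Suc n \<le> 2 * Suc (n div 2)" by presburger
        then have "real (Suc n) \<le> 2 * real (Suc (n div 2))" by linarith
        then have "c * real (Suc n) \<le> c * (2 * real (Suc (n div 2)))"
          using c by (intro mult_left_mono) auto
        then show ?thesis by (simp add: divide_le_eq le_divide_eq mult_ac)
      qed
      then have "(c / real (Suc (n div 2))) powr s \<le> (2 * c / real (Suc n)) powr s"
        using c assms by (intro powr_mono2) auto
      also have "\<dots> = (2 * c) powr s * (1 / real (Suc n) powr s)"
        using c by (simp add: powr_divide)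
      finally show "hausdorff_gauge s (U n) \<le> ennreal ((2 * c) powr s * (1 / real (Suc n) powr s))"
        using assms by (auto simp: hausdorff_gauge_def dU)
    qed auto
    also have "\<dots> = ennreal ((2 * c) powr s * z)"
      unfolding z_def suminf_mult[OF summ, symmetric]
      by (intro suminf_ennreal2 summable_mult summ) auto
    also have "\<dots> \<le> ennreal e" using c by (intro ennreal_leI) simp
    finally show ?thesis .
  qed
  have "hausdorff_premeasure s \<delta> A = 0" if "\<delta> > 0" for \<delta>
    using pre[OF that] by (metis ennreal_le_epsilon add_0 le_zero_eq)
  then show ?thesis by (simp add: hausdorff_measure_def)
qed

text \<open>The exponents \<open>1 + e\<close> give the upper bound in the limit. For the lower
  bound, every exponent in the infimum has measure zero and hence is at least
  \<open>1\<close>.\<close>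

lemma hausdorff_dim_real_eq_1:
  fixes A :: "real set"
  assumes "\<And>s. 0 \<le> s \<Longrightarrow> s < 1 \<Longrightarrow> hausdorff_measure s A \<noteq> 0"
  shows "hausdorff_dim A = 1"
proof (rule antisym)
  show "hausdorff_dim A \<le> 1"
  proof (rule ennreal_le_epsilon)
    fix e :: real assume "e > 0"
    then have "hausdorff_dim A \<le> ennreal (1 + e)"
      unfolding hausdorff_dim_def
      by (intro Inf_lower) (auto intro!: exI[of _ "1 + e"] hausdorff_measure_real_eq_0)
    then show "hausdorff_dim A \<le> 1 + ennreal e" using \<open>e > 0\<close> by (simp add: ennreal_plus)
  qed
  show "1 \<le> hausdorff_dim A"
    unfolding hausdorff_dim_def
  proof (rule Inf_greatest, clarify)
    fix s :: real assume "0 \<le> s" "hausdorff_measure s A = 0"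
    then have "1 \<le> s" using assms[of s] by force
    then show "1 \<le> ennreal s" by simp
  qed
qed

section \<open>Equidistributed digits\<close>

lemma infinite_in_limit_stride:
  assumes "infinite_in_limit Q" "D \<ge> 1"
  shows "filterlim (\<lambda>n. Q (Suc (n * D))) at_top sequentially"
  by (rule filterlim_compose[OF assms(1)[unfolded infinite_in_limit_def]])
     (use assms(2) in \<open>auto intro!: filterlim_subseq simp: strict_mono_def\<close>)

definition digit_frequency :: "(nat \<Rightarrow> nat) \<Rightarrow> (nat \<Rightarrow> nat) \<Rightarrow> nat \<Rightarrow> real \<Rightarrow> nat \<Rightarrow> real" where
  "digit_frequency Q E D t N =
     real (card {n. n < N \<and> real (E (Suc (n * D))) < t * real (Q (Suc (n * D)))}) / real N"

text \<open>Rational \<open>t\<close> are enough by density and leave only countably many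
  conditions, so that almost sure statements can be combined.\<close>

definition equidistributed_digits :: "(nat \<Rightarrow> nat) \<Rightarrow> (nat \<Rightarrow> nat) \<Rightarrow> bool" where
  "equidistributed_digits Q E \<longleftrightarrow>
     (\<forall>D\<in>{1..}. \<forall>t\<in>\<rat> \<inter> {0..1}. digit_frequency Q E D t \<longlonglongrightarrow> t)"

lemma equidistributed_digits_cong:
  assumes "\<And>n. n \<ge> 1 \<Longrightarrow> E n = F n"
  shows "equidistributed_digits Q E \<longleftrightarrow> equidistributed_digits Q F"
  unfolding equidistributed_digits_def digit_frequency_def[abs_def] using assms by simp

text \<open>The stride \<open>D\<close> serves block products: the shifts of a base formed by multiplying
  \<open>D\<close> consecutive terms of \<open>Q\<close> are every \<open>D\<close>-th shift of \<open>Q\<close>.\<close>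

lemma equidistributed_digits_infinite:
  assumes Q: "basic_sequence Q" and E: "equidistributed_digits Q E"
  shows "infinite {n. n \<ge> 1 \<and> E n \<noteq> Q n - 1}"
proof
  assume "finite {n. n \<ge> 1 \<and> E n \<noteq> Q n - 1}"
  then have fin: "finite {n. Suc n \<in> {n. n \<ge> 1 \<and> E n \<noteq> Q n - 1}}"
    by (rule finite_vimageI[of _ Suc, unfolded vimage_def]) simp
  define C where "C = card {n. Suc n \<in> {n. n \<ge> 1 \<and> E n \<noteq> Q n - 1}}"
  \<comment> \<open>A maximal digit is at least half its base, so it is never counted at threshold
    \<open>1/2\<close>. With only finitely many other digits the frequency would tend to
    \<open>0\<close>.\<close>
  have le: "digit_frequency Q E 1 (1/2) N \<le> real C / real N" for N
  proof -
    have "{n. n < N \<and> real (E (Suc (n * 1))) < 1/2 * real (Q (Suc (n * 1)))}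
        \<subseteq> {n. Suc n \<in> {n. n \<ge> 1 \<and> E n \<noteq> Q n - 1}}"
    proof safe
      fix n assume n: "real (E (Suc (n * 1))) < 1/2 * real (Q (Suc (n * 1)))"
        "E (Suc n) = Q (Suc n) - 1"
      have "Q (Suc n) \<ge> 2" using Q by (simp add: basic_sequence_def)
      with n show False by (simp add: of_nat_diff)
    qed simp
    from card_mono[OF fin this] show ?thesis
      unfolding digit_frequency_def C_def by (intro divide_right_mono of_nat_mono) auto
  qed
  have "digit_frequency Q E 1 (1/2) \<longlonglongrightarrow> 1/2"
    using E unfolding equidistributed_digits_def by (auto simp: Rats_divide)
  then have "1/2 \<le> (0::real)"
    by (rule LIMSEQ_le[OF _ lim_const_over_n[of "real C"]]) (use le in auto)
  then show False by simp
qed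

lemma uniformly_distributed_mod1_if_initial:
  assumes y: "\<And>n. 0 \<le> y n" "\<And>n. y n < 1"
    and lim: "\<And>t. 0 \<le> t \<Longrightarrow> t \<le> 1 \<Longrightarrow>
      (\<lambda>N. real (card {n. n < N \<and> y n < t}) / real N) \<longlonglongrightarrow> t"
  shows "uniformly_distributed_mod1 y"
  unfolding uniformly_distributed_mod1_def
proof (intro allI impI)
  fix a b :: real assume ab: "0 \<le> a \<and> a < b \<and> b \<le> 1"
  have "real (card {n. n < N \<and> frac (y n) \<in> {a..<b}}) / real N =
     real (card {n. n < N \<and> y n < b}) / real N - real (card {n. n < N \<and> y n < a}) / real N" for N
  proof -
    have "frac (y n) = y n" for n using y by (simp add: frac_eq)
    then have "{n. n < N \<and> frac (y n) \<in> {a..<b}} = {n. n < N \<and> y n < b} - {n. n < N \<and> y n < a}"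
      using ab by auto
    moreover have sub: "{n. n < N \<and> y n < a} \<subseteq> {n. n < N \<and> y n < b}" using ab by auto
    ultimately show ?thesis
      using card_mono[OF _ sub] by (simp add: card_Diff_subset of_nat_diff diff_divide_distrib)
  qed
  then show "(\<lambda>N. real (card {n. n < N \<and> frac (y n) \<in> {a..<b}}) / real N) \<longlonglongrightarrow> b - a"
    using tendsto_diff[OF lim[of b] lim[of a]] ab by simp
qed

text \<open>The shift differs from \<open>e n / q n\<close> by less than \<open>1 / q n\<close>,
  which tends to \<open>0\<close>. Hence frequencies of shifts below \<open>t\<close> are squeezed
  between digit frequencies at rational thresholds near \<open>t\<close>.\<close>

lemma equidistributed_digits_shift:
  assumes Q: "basic_sequence Q" and lim: "infinite_in_limit Q" and E: "is_cantor_expansion Q x E"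
    and eq: "equidistributed_digits Q E" and D: "D \<ge> 1"
  shows "uniformly_distributed_mod1 (\<lambda>n. cantor_shift Q (n * D) x)"
proof (rule uniformly_distributed_mod1_if_initial)
  fix t :: real assume t: "0 \<le> t" "t \<le> 1"
  define T where "T n = cantor_shift Q (n * D) x" for n
  define q where "q n = real (Q (Suc (n * D)))" for n
  define e where "e n = real (E (Suc (n * D)))" for n
  have qpos: "q n > 0" for n
    using is_cantor_expansion_lt[OF Q E, of "Suc (n * D)"] by (simp add: q_def)
  have qT: "e n \<le> q n * T n" "q n * T n < e n + 1" for n
    using cantor_shift_Suc[OF Q E, of "n * D"] cantor_shift_bounds[of Q "Suc (n * D)" x]
    by (auto simp: q_def T_def e_def)
  have freq: "digit_frequency Q E D r = (\<lambda>N. real (card {n. n < N \<and> e n < r * q n}) / real N)" for r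
    by (simp add: digit_frequency_def[abs_def] e_def q_def)
  have G: "digit_frequency Q E D r \<longlonglongrightarrow> r" if "r \<in> \<rat>" "0 \<le> r" "r \<le> 1" for r
    using eq D that unfolding equidistributed_digits_def by auto
  define F where "F N = real (card {n. n < N \<and> T n < t}) / real N" for N
  have "F \<longlonglongrightarrow> t"
  proof (rule order_tendstoI)
    fix a assume "a < t"
    have F0: "F N \<ge> 0" for N by (simp add: F_def)
    show "\<forall>\<^sub>F N in sequentially. a < F N"
    \<comment> \<open>For negative \<open>a\<close>, as for \<open>b > 1\<close> below, the bound is
      trivial; otherwise the rational \<open>r\<close> lies in the unit interval, where
      \<open>G\<close> applies.\<close>
    proof (cases "a < 0")
      case True
      then show ?thesis using F0 by (auto intro: always_eventually less_le_trans)
    next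
      case False
      obtain r where r: "r \<in> \<rat>" "a < r" "r < t" using Rats_dense_in_real[OF \<open>a < t\<close>] by blast
      have "\<forall>\<^sub>F n in sequentially. nat \<lceil>1 / (t - r)\<rceil> \<le> Q (Suc (n * D))"
        using infinite_in_limit_stride[OF lim D] unfolding filterlim_at_top by blast
      then obtain K where K: "\<And>n. n \<ge> K \<Longrightarrow> nat \<lceil>1 / (t - r)\<rceil> \<le> Q (Suc (n * D))"
        by (auto simp: eventually_sequentially)
      \<comment> \<open>Beyond \<open>K\<close> the rounding error \<open>1\<close> fits into the
        gap between \<open>r * q n\<close> and \<open>t * q n\<close>; the first \<open>K\<close>
        indices cost at most \<open>K / N\<close>.\<close>
      have K': "r * q n + 1 \<le> t * q n" if "n \<ge> K" for n
      proof -
        have "1 / (t - r) \<le> q n" using K[OF that] r unfolding q_def by linarith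
        then show ?thesis using r by (simp add: divide_le_eq algebra_simps)
      qed
      have le: "digit_frequency Q E D r N - real K / real N \<le> F N" for N
      proof -
        have "{n. n < N \<and> e n < r * q n} \<subseteq> {n. n < N \<and> T n < t} \<union> {..<K}"
        proof
          fix n assume n: "n \<in> {n. n < N \<and> e n < r * q n}"
          have "T n < t" if "n \<ge> K"
          proof -
            have "q n * T n < q n * t" using qT(2)[of n] K'[OF that] n by (simp add: mult.commute)
            then show ?thesis using qpos[of n] by simp
          qed
          with n show "n \<in> {n. n < N \<and> T n < t} \<union> {..<K}" by force
        qed
        then have "card {n. n < N \<and> e n < r * q n} \<le> card ({n. n < N \<and> T n < t} \<union> {..<K})"
          by (intro card_mono) auto
        also have "\<dots> \<le> card {n. n < N \<and> T n < t} + K"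
          using card_Un_le[of "{n. n < N \<and> T n < t}" "{..<K}"] by simp
        finally have "real (card {n. n < N \<and> e n < r * q n}) \<le> real (card {n. n < N \<and> T n < t}) + real K"
          by linarith
        from divide_right_mono[OF this, of "real N"] show ?thesis
          by (simp add: freq F_def add_divide_distrib)
      qed
      have "(\<lambda>N. digit_frequency Q E D r N - real K / real N) \<longlonglongrightarrow> r - 0"
        using r False t by (intro tendsto_diff G lim_const_over_n) auto
      then have "\<forall>\<^sub>F N in sequentially. a < digit_frequency Q E D r N - real K / real N"
        using r by (intro order_tendstoD) auto
      then show ?thesis by eventually_elim (use le in \<open>auto intro: less_le_trans\<close>)
    qed
  next
    fix b assume "t < b"
    have F1: "F N \<le> 1" for N
    proof -
      have "card {n. n < N \<and> T n < t} \<le> card {..<N}" by (intro card_mono) auto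
      then show ?thesis by (simp add: F_def divide_le_eq)
    qed
    show "\<forall>\<^sub>F N in sequentially. F N < b"
    proof (cases "b > 1")
      case True
      then show ?thesis using F1 by (auto intro: always_eventually le_less_trans)
    next
      case False
      obtain r where r: "r \<in> \<rat>" "t < r" "r < b" using Rats_dense_in_real[OF \<open>t < b\<close>] by blast
      \<comment> \<open>Rounding down only helps in this direction, so there are no exceptional
        indices.\<close>
      have le: "F N \<le> digit_frequency Q E D r N" for N
      proof -
        have "e n < r * q n" if "T n < t" for n
        proof -
          have "e n \<le> q n * T n" by (rule qT)
          also have "\<dots> < q n * r" using that r qpos[of n] by simp
          finally show ?thesis by (simp add: mult.commute)
        qed
        then have "card {n. n < N \<and> T n < t} \<le> card {n. n < N \<and> e n < r * q n}"
          by (intro card_mono) auto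
        then show ?thesis unfolding freq F_def by (intro divide_right_mono) auto
      qed
      have "\<forall>\<^sub>F N in sequentially. digit_frequency Q E D r N < b"
        using r False t by (intro order_tendstoD[OF G]) auto
      then show ?thesis by eventually_elim (use le in \<open>auto intro: le_less_trans\<close>)
    qed
  qed
  then show "(\<lambda>N. real (card {n. n < N \<and> cantor_shift Q (n * D) x < t}) / real N) \<longlonglongrightarrow> t"
    by (simp add: F_def[abs_def] T_def)
qed (rule cantor_shift_bounds)+

text \<open>The last digit is the remainder of the prefix modulo the last base, and the rest follows
  by induction. Thus a prefix value singles out one cylinder.\<close>

lemma cantor_prefix_eq_imp_digits_eq:
  assumes "\<And>i. i \<ge> 1 \<Longrightarrow> E i < Q i" "\<And>i. i \<ge> 1 \<Longrightarrow> F i < Q i"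
    and "cantor_prefix Q E n = cantor_prefix Q F n"
  shows "\<forall>i\<in>{1..n}. E i = F i"
  using assms(3)
proof (induction n)
  case (Suc n)
  have lt: "E (Suc n) < Q (Suc n)" "F (Suc n) < Q (Suc n)" using assms by simp_all
  have eq: "cantor_prefix Q E n * Q (Suc n) + E (Suc n) = cantor_prefix Q F n * Q (Suc n) + F (Suc n)"
    using Suc.prems by simp
  from arg_cong[OF eq, of "\<lambda>m. m mod Q (Suc n)"] have "E (Suc n) = F (Suc n)" using lt by simp
  moreover from this have "cantor_prefix Q E n = cantor_prefix Q F n" using eq lt by simp
  ultimately show ?case using Suc.IH by (auto simp: le_Suc_eq)
qed simp

lemma card_nat_between:
  fixes a b :: real
  assumes "a \<le> b"
  shows "finite {k. a \<le> real k \<and> real k \<le> b}" "real (card {k. a \<le> real k \<and> real k \<le> b}) \<le> b - a + 1"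
proof -
  have sub: "{k. a \<le> real k \<and> real k \<le> b} \<subseteq> nat ` {\<lceil>a\<rceil>..\<lfloor>b\<rfloor>}"
  proof
    fix k assume "k \<in> {k. a \<le> real k \<and> real k \<le> b}"
    then have "int k \<in> {\<lceil>a\<rceil>..\<lfloor>b\<rfloor>}" by (auto simp: ceiling_le_iff le_floor_iff)
    then have "nat (int k) \<in> nat ` {\<lceil>a\<rceil>..\<lfloor>b\<rfloor>}" by (rule imageI)
    then show "k \<in> nat ` {\<lceil>a\<rceil>..\<lfloor>b\<rfloor>}" by simp
  qed
  then show "finite {k. a \<le> real k \<and> real k \<le> b}" by (rule finite_subset) simp
  have "card {k. a \<le> real k \<and> real k \<le> b} \<le> card (nat ` {\<lceil>a\<rceil>..\<lfloor>b\<rfloor>})"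
    using sub by (rule card_mono[rotated]) simp
  also have "\<dots> \<le> nat (\<lfloor>b\<rfloor> - \<lceil>a\<rceil> + 1)" using card_image_le[of "{\<lceil>a\<rceil>..\<lfloor>b\<rfloor>}" nat] by simp
  finally show "real (card {k. a \<le> real k \<and> real k \<le> b}) \<le> b - a + 1"
    using assms by linarith
qed

section \<open>Random digits\<close>

definition digit_measure :: "(nat \<Rightarrow> nat) \<Rightarrow> nat \<Rightarrow> (nat \<Rightarrow> nat) measure" where
  "digit_measure Q c = PiM UNIV (\<lambda>n. measure_pmf (pmf_of_set {c..<Q n}))"

text \<open>Coordinate \<open>0\<close> is irrelevant, and its set of digits may be empty.\<close>

locale random_cantor_digits =
  fixes Q :: "nat \<Rightarrow> nat" and c :: nat
  assumes basic: "basic_sequence Q" and inf_lim: "infinite_in_limit Q" and c_le_1: "c \<le> 1"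
begin

abbreviation P :: "(nat \<Rightarrow> nat) measure" where
  "P \<equiv> digit_measure Q c"

lemma Q_ge_2: "n \<ge> 1 \<Longrightarrow> Q n \<ge> 2"
  using basic by (simp add: basic_sequence_def)

lemma product_prob_space_digits: "product_prob_space (\<lambda>n. measure_pmf (pmf_of_set {c..<Q n}))"
  by (intro product_prob_spaceI prob_space_measure_pmf)

lemma prob_space_P: "prob_space P"
  unfolding digit_measure_def by (intro prob_space_PiM prob_space_measure_pmf)

lemma space_P [simp]: "space P = UNIV"
  by (simp add: digit_measure_def space_PiM)

lemma measurable_digit [measurable]: "(\<lambda>\<omega>. \<omega> n) \<in> P \<rightarrow>\<^sub>M count_space UNIV"
proof -
  have "(\<lambda>\<omega>. \<omega> n) \<in> P \<rightarrow>\<^sub>M measure_pmf (pmf_of_set {c..<Q n})"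
    unfolding digit_measure_def by (rule measurable_component_singleton) simp
  then show ?thesis by simp
qed

lemma sets_digit: "{\<omega>. \<omega> n \<in> A} \<in> sets P"
  using measurable_sets[OF measurable_digit, of A n] by (simp add: vimage_def)

lemma sets_cylinder: "finite J \<Longrightarrow> {\<omega>. \<forall>i\<in>J. \<omega> i \<in> A i} \<in> sets P"
  using sets.sets_Collect_finite_All[of J P "\<lambda>i \<omega>. \<omega> i \<in> A i"] by (simp add: sets_digit)

lemma measurable_cantor_prefix [measurable]:
  "(\<lambda>\<omega>. cantor_prefix Q \<omega> n) \<in> P \<rightarrow>\<^sub>M count_space UNIV"
  by (induction n) simp_all

lemma measurable_cantor_value [measurable]: "cantor_value Q \<in> borel_measurable P"
  unfolding cantor_value_def[abs_def] by measurable

lemma measure_digit: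
  assumes "n \<ge> 1"
  shows "measure (measure_pmf (pmf_of_set {c..<Q n})) A = real (card ({c..<Q n} \<inter> A)) / real (Q n - c)"
  using Q_ge_2[OF assms] c_le_1 by (subst measure_pmf_of_set) auto

lemma measure_cylinder:
  assumes "finite J"
  shows "measure P {\<omega>. \<forall>i\<in>J. \<omega> i \<in> A i} = (\<Prod>i\<in>J. measure (measure_pmf (pmf_of_set {c..<Q i})) (A i))"
proof -
  interpret D: product_prob_space "\<lambda>n. measure_pmf (pmf_of_set {c..<Q n})" UNIV
    by (rule product_prob_space_digits)
  have "emeasure P {\<omega>. \<forall>i\<in>J. \<omega> i \<in> A i} = (\<Prod>i\<in>J. emeasure (measure_pmf (pmf_of_set {c..<Q i})) (A i))"
    using D.emeasure_PiM_Collect[of J A] assms unfolding digit_measure_def by (simp add: space_PiM)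
  then have "ennreal (measure P {\<omega>. \<forall>i\<in>J. \<omega> i \<in> A i}) =
      ennreal (\<Prod>i\<in>J. measure (measure_pmf (pmf_of_set {c..<Q i})) (A i))"
    by (simp add: finite_measure.emeasure_eq_measure[OF prob_space.finite_measure[OF prob_space_P]]
        measure_pmf.emeasure_eq_measure prod_ennreal)
  then show ?thesis by (subst (asm) ennreal_inj) (auto intro: prod_nonneg)
qed

lemma measure_single_digit:
  "measure P {\<omega>. \<omega> n \<in> A} = measure (measure_pmf (pmf_of_set {c..<Q n})) A"
  using measure_cylinder[of "{n}" "\<lambda>_. A"] by simp

section \<open>Almost sure behaviour of the random digits\<close>

lemma AE_digits_in_range: "AE \<omega> in P. \<forall>n\<ge>1. c \<le> \<omega> n \<and> \<omega> n < Q n"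
  unfolding AE_all_countable
proof
  fix n
  show "AE \<omega> in P. n \<ge> 1 \<longrightarrow> c \<le> \<omega> n \<and> \<omega> n < Q n"
  proof (cases "n \<ge> 1")
    case True
    have "{c..<Q n} \<noteq> {}" using Q_ge_2[OF True] c_le_1 by auto
    then have "AE k in measure_pmf (pmf_of_set {c..<Q n}). c \<le> k \<and> k < Q n"
      by (auto simp: AE_measure_pmf_iff)
    then have "AE \<omega> in P. c \<le> \<omega> n \<and> \<omega> n < Q n"
      unfolding digit_measure_def
      by (intro AE_PiM_component[where P = "\<lambda>k. c \<le> k \<and> k < Q n"] prob_space_measure_pmf) auto
    then show ?thesis by simp
  qed simp
qed

text \<open>Rounding \<open>t * Q n\<close> up and dropping at most one digit are errors of opposite
  sign, so together they stay within \<open>1\<close>.\<close>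

lemma card_digits_below:
  assumes "0 \<le> t" "t \<le> 1" "n \<ge> 1"
  shows "\<bar>real (card ({c..<Q n} \<inter> {k. real k < t * real (Q n)})) - t * real (Q n)\<bar> \<le> 1"
proof -
  define m where "m = nat \<lceil>t * real (Q n)\<rceil>"
  have "0 \<le> t * real (Q n)" using assms by simp
  then have m: "real m \<ge> t * real (Q n)" "real m < t * real (Q n) + 1"
    unfolding m_def by linarith+
  have "t * real (Q n) \<le> 1 * real (Q n)" using assms by (intro mult_right_mono) auto
  then have "m \<le> Q n" unfolding m_def by linarith
  have below: "{k. real k < t * real (Q n)} = {..<m}"
  proof (intro set_eqI iffI)
    fix k
    show "k \<in> {..<m}" if "k \<in> {k. real k < t * real (Q n)}"
      using that m(1) unfolding mem_Collect_eq lessThan_iff by linarith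
    show "k \<in> {k. real k < t * real (Q n)}" if "k \<in> {..<m}"
      using that m(2) unfolding mem_Collect_eq lessThan_iff by linarith
  qed
  have "{c..<Q n} \<inter> {..<m} = {c..<m}" using \<open>m \<le> Q n\<close> by auto
  then have "card ({c..<Q n} \<inter> {k. real k < t * real (Q n)}) = m - c" unfolding below by simp
  then show ?thesis using m c_le_1 by linarith
qed

text \<open>Distinct indices use distinct coordinates, which gives pairwise independence. The
  probabilities tend to \<open>t\<close> because the counting error is bounded while the bases tend
  to infinity.\<close>

lemma AE_digit_frequency:
  assumes t: "0 \<le> t" "t \<le> 1" and D: "D \<ge> 1"
  shows "AE \<omega> in P. digit_frequency Q \<omega> D t \<longlonglongrightarrow> t"
proof -
  interpret prob_space P by (rule prob_space_P)
  define B where "B n = {k. real k < t * real (Q (Suc (n * D)))}" for n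
  define A where "A n = {\<omega>. \<omega> (Suc (n * D)) \<in> B n}" for n
  have A_events: "A n \<in> events" for n unfolding A_def by (rule sets_digit)
  have prob_A: "prob (A n) = real (card ({c..<Q (Suc (n * D))} \<inter> B n)) / real (Q (Suc (n * D)) - c)" for n
    unfolding A_def measure_single_digit by (rule measure_digit) simp
  have "prob (A i \<inter> A j) = prob (A i) * prob (A j)" if "i \<noteq> j" for i j
  proof -
    have ne: "Suc (i * D) \<noteq> Suc (j * D)" using that D by simp
    define S where "S k = (if k = Suc (i * D) then B i else B j)" for k
    have "A i \<inter> A j = {\<omega>. \<forall>k\<in>{Suc (i * D), Suc (j * D)}. \<omega> k \<in> S k}"
      using ne by (auto simp: A_def S_def)
    then show ?thesis
      using ne by (simp only: measure_cylinder finite.intros) (simp add: A_def measure_single_digit S_def)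
  qed
  moreover have "(\<lambda>n. prob (A n)) \<longlonglongrightarrow> t"
  proof -
    \<comment> \<open>In the numerator \<open>2\<close>, one unit comes from
      \<open>card_digits_below\<close> and one from dividing by \<open>Q - c\<close> in place of
      \<open>Q\<close>.\<close>
    have bound: "norm (prob (A n) - t) \<le> 2 / (real (Q (Suc (n * D))) - 1)" for n
    proof -
      define q where "q = Q (Suc (n * D))"
      define m where "m = real (card ({c..<q} \<inter> B n))"
      have q2: "q \<ge> 2" using Q_ge_2[of "Suc (n * D)"] by (simp add: q_def)
      have m: "\<bar>m - t * real q\<bar> \<le> 1"
        using card_digits_below[OF t, of "Suc (n * D)"] by (simp add: m_def q_def B_def)
      have qc: "real (q - c) = real q - real c" using q2 c_le_1 by (simp add: of_nat_diff)
      have "t * real c \<le> 1 * 1" using t c_le_1 by (intro mult_mono) auto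
      then have "\<bar>m - t * (real q - real c)\<bar> \<le> 2"
        using m t by (simp add: algebra_simps) (smt (verit) mult_nonneg_nonneg of_nat_0_le_iff)
      moreover have "prob (A n) - t = (m - t * (real q - real c)) / (real q - real c)"
        using q2 c_le_1 unfolding prob_A qc[unfolded q_def] m_def q_def
        by (simp add: diff_divide_distrib)
      ultimately have "norm (prob (A n) - t) \<le> 2 / (real q - real c)"
        using q2 c_le_1 by (simp add: abs_divide divide_right_mono)
      also have "\<dots> \<le> 2 / (real q - 1)" using q2 c_le_1 by (intro divide_left_mono mult_pos_pos) auto
      finally show ?thesis by (simp add: q_def)
    qed
    have "filterlim (\<lambda>n. - 1 + real (Q (Suc (n * D)))) at_top sequentially"
      by (intro filterlim_tendsto_add_at_top[OF tendsto_const]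
          filterlim_compose[OF filterlim_real_sequentially] infinite_in_limit_stride inf_lim D)
    then have "(\<lambda>n. 2 / (real (Q (Suc (n * D))) - 1)) \<longlonglongrightarrow> 0"
      by (intro tendsto_divide_0[OF tendsto_const] filterlim_at_top_imp_at_infinity) simp
    then have "(\<lambda>n. prob (A n) - t) \<longlonglongrightarrow> 0"
      by (rule Lim_null_comparison[OF always_eventually, rotated]) (use bound in auto)
    then show ?thesis by (simp add: LIM_zero_iff)
  qed
  ultimately have "AE \<omega> in P. (\<lambda>N. real (card {n. n < N \<and> \<omega> \<in> A n}) / real N) \<longlonglongrightarrow> t"
    by (intro strong_law_pairwise_indep_events A_events)
  then show ?thesis by (simp add: A_def B_def digit_frequency_def[abs_def])
qed

lemma AE_equidistributed_digits: "AE \<omega> in P. equidistributed_digits Q \<omega>"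
proof -
  have "AE \<omega> in P. \<forall>D\<in>{1..}. \<forall>t\<in>\<rat> \<inter> {0..1}. digit_frequency Q \<omega> D t \<longlonglongrightarrow> t"
    by (intro AE_ball_countable[THEN iffD2] ballI AE_digit_frequency)
       (auto intro: countable_Int1 countable_rat)
  then show ?thesis by (simp add: equidistributed_digits_def)
qed

lemma AE_cantor_expansion: "AE \<omega> in P. is_cantor_expansion Q (cantor_value Q \<omega>) \<omega>"
  using AE_equidistributed_digits AE_digits_in_range
proof eventually_elim
  case (elim \<omega>)
  then show ?case
    by (intro is_cantor_expansion_cantor_value equidistributed_digits_infinite basic) auto
qed

section \<open>Cylinder masses and Hoelder continuity of the law\<close>

definition cylinder_mass :: "nat \<Rightarrow> real" where
  "cylinder_mass n = (\<Prod>i=1..n. 1 / real (Q i - c))"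

lemma cylinder_mass_nonneg: "0 \<le> cylinder_mass n"
  unfolding cylinder_mass_def by (intro prod_nonneg) auto

text \<open>For digits in range the prefix determines the first \<open>n\<close> digits, so the
  event is empty or lies in a single cylinder.\<close>

lemma measure_prefix_le:
  "measure P {\<omega>. cantor_prefix Q \<omega> n = k \<and> (\<forall>i\<ge>1. \<omega> i < Q i)} \<le> cylinder_mass n"
proof (cases "{\<omega>. cantor_prefix Q \<omega> n = k \<and> (\<forall>i\<ge>1. \<omega> i < Q i)} = {}")
  case True
  then show ?thesis using cylinder_mass_nonneg by (simp only: measure_empty)
next
  case False
  interpret prob_space P by (rule prob_space_P)
  from False obtain E where E: "cantor_prefix Q E n = k" "\<And>i. i \<ge> 1 \<Longrightarrow> E i < Q i" by auto
  have "{\<omega>. cantor_prefix Q \<omega> n = k \<and> (\<forall>i\<ge>1. \<omega> i < Q i)} \<subseteq> {\<omega>. \<forall>i\<in>{1..n}. \<omega> i \<in> {E i}}"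
    using cantor_prefix_eq_imp_digits_eq[of _ Q E n] E by auto
  moreover have "{\<omega>. \<forall>i\<in>{1..n}. \<omega> i \<in> {E i}} \<in> events" by (rule sets_cylinder) simp
  ultimately have "prob {\<omega>. cantor_prefix Q \<omega> n = k \<and> (\<forall>i\<ge>1. \<omega> i < Q i)}
      \<le> prob {\<omega>. \<forall>i\<in>{1..n}. \<omega> i \<in> {E i}}"
    by (intro finite_measure_mono) auto
  also have "\<dots> = (\<Prod>i=1..n. measure (measure_pmf (pmf_of_set {c..<Q i})) {E i})"
    by (rule measure_cylinder) simp
  also have "\<dots> \<le> cylinder_mass n"
    unfolding cylinder_mass_def
  proof (intro prod_mono conjI)
    fix i assume "i \<in> {1..n}"
    then have "measure (measure_pmf (pmf_of_set {c..<Q i})) {E i} = real (card ({c..<Q i} \<inter> {E i})) / real (Q i - c)"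
      by (intro measure_digit) simp
    also have "\<dots> \<le> 1 / real (Q i - c)"
      using card_mono[of "{E i}" "{c..<Q i} \<inter> {E i}"] by (intro divide_right_mono) auto
    finally show "measure (measure_pmf (pmf_of_set {c..<Q i})) {E i} \<le> 1 / real (Q i - c)" .
  qed simp
  finally show ?thesis .
qed

text \<open>With \<open>a = base_prod Q n\<close>, a value in the interval forces its prefix to be
  an integer between \<open>a * u - 1\<close> and \<open>a * v\<close>. There are at most
  \<open>(v - u) * a + 2\<close> of these, each of mass at most
  \<open>cylinder_mass n\<close>.\<close>

lemma measure_interval_le:
  assumes "u \<le> v"
  shows "measure P {\<omega>. cantor_value Q \<omega> \<in> {u..v}} \<le>
    ((v - u) * real (base_prod Q n) + 2) * cylinder_mass n"
proof -
  interpret prob_space P by (rule prob_space_P)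
  define a where "a = real (base_prod Q n)"
  have a: "a > 0" using base_prod_pos[OF basic] by (simp add: a_def)
  define I where "I = {k. a * u - 1 \<le> real k \<and> real k \<le> a * v}"
  have "a * u \<le> a * v" using a assms by simp
  then have I: "finite I" "real (card I) \<le> (v - u) * a + 2"
    using card_nat_between[of "a * u - 1" "a * v"] by (auto simp: I_def algebra_simps)
  define S where "S k = {\<omega>. cantor_prefix Q \<omega> n = k \<and> (\<forall>i\<ge>1. \<omega> i < Q i)}" for k
  have S_events: "S k \<in> events" for k
  proof -
    have "{\<omega> \<in> space P. cantor_prefix Q \<omega> n = k \<and> (\<forall>i\<in>{1..}. \<omega> i < Q i)} \<in> events" by measurable
    then show ?thesis by (simp add: S_def Ball_def)
  qed
  have "prob {\<omega>. cantor_value Q \<omega> \<in> {u..v}} \<le> prob (\<Union>k\<in>I. S k)"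
  proof (rule finite_measure_mono_AE)
    show "AE \<omega> in P. \<omega> \<in> {\<omega>. cantor_value Q \<omega> \<in> {u..v}} \<longrightarrow> \<omega> \<in> (\<Union>k\<in>I. S k)"
      using AE_digits_in_range
    proof eventually_elim
      case (elim \<omega>)
      show ?case
      proof
        assume "\<omega> \<in> {\<omega>. cantor_value Q \<omega> \<in> {u..v}}"
        then have "a * u \<le> a * cantor_value Q \<omega>" "a * cantor_value Q \<omega> \<le> a * v" using a by auto
        then have "cantor_prefix Q \<omega> n \<in> I"
          using cantor_value_bounds[OF basic, of \<omega> n] elim by (auto simp: I_def a_def)
        then show "\<omega> \<in> (\<Union>k\<in>I. S k)" using elim by (auto simp: S_def)
      qed
    qed
    show "(\<Union>k\<in>I. S k) \<in> events" using I(1) S_events by auto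
  qed
  also have "\<dots> \<le> (\<Sum>k\<in>I. prob (S k))"
    using I(1) S_events by (intro finite_measure_subadditive_finite) auto
  also have "\<dots> \<le> real (card I) * cylinder_mass n"
    unfolding S_def by (intro sum_bounded_above measure_prefix_le)
  also have "\<dots> \<le> ((v - u) * a + 2) * cylinder_mass n"
    using I(2) by (intro mult_right_mono cylinder_mass_nonneg)
  finally show ?thesis by (simp add: a_def)
qed

text \<open>The left side is the product of the ratios \<open>Q i / (Q i - c)\<close>, each at most
  \<open>2\<close>. Up to index \<open>N\<close> these are paid by powers of \<open>2\<close>,
  afterwards by \<open>Q i powr (1 - s)\<close>.\<close>

lemma base_prod_cylinder_mass_le:
  assumes N: "\<And>i. i > N \<Longrightarrow> 2 \<le> real (Q i) powr (1 - s)" and s: "s < 1"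
  shows "real (base_prod Q n) * cylinder_mass n \<le> 2 ^ min n N * real (base_prod Q n) powr (1 - s)"
proof (induction n)
  case (Suc n)
  define q where "q = real (Q (Suc n))"
  define r where "r = q / real (Q (Suc n) - c)"
  have q2: "q \<ge> 2" using Q_ge_2[of "Suc n"] by (simp add: q_def)
  have "real (Q (Suc n) - c) \<ge> q - 1" using c_le_1 unfolding q_def by linarith
  then have r: "0 \<le> r" "r \<le> 2" using q2 by (auto simp: r_def q_def divide_le_eq)
  have "1 \<le> q powr (1 - s)" using q2 s by (intro ge_one_powr_ge_zero) auto
  then have rq: "r * 2 ^ min n N \<le> 2 ^ min (Suc n) N * q powr (1 - s)"
  proof (cases "n < N")
    case True
    then have "min n N = n" "min (Suc n) N = Suc n" by auto
    then have "r * 2 ^ min n N \<le> 2 ^ min (Suc n) N * 1" using r by simp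
    also have "\<dots> \<le> 2 ^ min (Suc n) N * q powr (1 - s)"
      using \<open>1 \<le> q powr (1 - s)\<close> by (intro mult_left_mono) auto
    finally show ?thesis .
  next
    case False
    then have "min n N = N" "min (Suc n) N = N" by auto
    moreover have "r \<le> q powr (1 - s)" using N[of "Suc n"] False r by (simp add: q_def)
    ultimately show ?thesis by (simp add: mult.commute)
  qed
  have "real (base_prod Q (Suc n)) * cylinder_mass (Suc n) = r * (real (base_prod Q n) * cylinder_mass n)"
    by (simp add: cylinder_mass_def r_def q_def)
  also have "\<dots> \<le> r * (2 ^ min n N * real (base_prod Q n) powr (1 - s))"
    using r by (intro mult_left_mono Suc.IH)
  also have "\<dots> = (r * 2 ^ min n N) * real (base_prod Q n) powr (1 - s)" by simp
  also have "\<dots> \<le> (2 ^ min (Suc n) N * q powr (1 - s)) * real (base_prod Q n) powr (1 - s)"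
    by (intro mult_right_mono rq) simp
  also have "\<dots> = 2 ^ min (Suc n) N * real (base_prod Q (Suc n)) powr (1 - s)"
    by (simp add: q_def powr_mult)
  finally show ?case .
qed (simp add: cylinder_mass_def)

text \<open>For length \<open>r\<close>, cylinders are counted at the first level
  \<open>Suc n\<close> whose scale is below \<open>r\<close>. The resulting bound is then expressed
  at level \<open>n\<close>, whose scale is at least \<open>r\<close>, so that
  \<open>a n powr (1 - s)\<close> is at most \<open>r powr (s - 1)\<close>.\<close>

lemma measure_interval_holder:
  assumes s: "0 \<le> s" "s < 1"
  shows "\<exists>C. \<forall>u v. u < v \<longrightarrow> v - u \<le> 1 \<longrightarrow>
    measure P {\<omega>. cantor_value Q \<omega> \<in> {u..v}} \<le> C * (v - u) powr s"
proof -
  have "\<forall>\<^sub>F i in sequentially. nat \<lceil>2 powr (1 / (1 - s))\<rceil> \<le> Q i"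
    using inf_lim unfolding infinite_in_limit_def filterlim_at_top by blast
  \<comment> \<open>The threshold solves \<open>q powr (1 - s) = 2\<close>.\<close>
  then obtain N where N': "\<And>i. i \<ge> N \<Longrightarrow> nat \<lceil>2 powr (1 / (1 - s))\<rceil> \<le> Q i"
    by (auto simp: eventually_sequentially)
  have N: "2 \<le> real (Q i) powr (1 - s)" if "i \<ge> N" for i
  proof -
    have "2 powr (1 / (1 - s)) \<le> real (Q i)" using N'[OF that] by linarith
    then have "(2 powr (1 / (1 - s))) powr (1 - s) \<le> real (Q i) powr (1 - s)"
      using s by (intro powr_mono2) auto
    then show ?thesis using s by (simp add: powr_powr)
  qed
  \<comment> \<open>The factor \<open>6\<close> is \<open>3\<close> from the count of cylinders
    times \<open>2\<close> from the step back to level \<open>n\<close>; \<open>2 ^ N\<close> pays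
    for the small bases.\<close>
  define C where "C = (6 * 2 ^ N :: real)"
  have "measure P {\<omega>. cantor_value Q \<omega> \<in> {u..v}} \<le> C * (v - u) powr s" if uv: "u < v" "v - u \<le> 1" for u v
  proof -
    define r where "r = v - u"
    define a where "a n = real (base_prod Q n)" for n
    have r: "0 < r" "r \<le> 1" using uv by (auto simp: r_def)
    have a: "a n > 0" for n using base_prod_pos[OF basic] by (simp add: a_def)
    have "\<forall>\<^sub>F n in sequentially. 1 / a (Suc n) < r"
      using order_tendstoD(2)[OF LIMSEQ_Suc[OF inverse_base_prod_tendsto_0[OF basic]] r(1)]
      unfolding a_def .
    then have ex: "\<exists>n. 1 / a (Suc n) < r" by (auto simp: eventually_sequentially)
    define n where "n = (LEAST n. 1 / a (Suc n) < r)"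
    have n: "1 / a (Suc n) < r" unfolding n_def by (rule LeastI_ex[OF ex])
    have n': "r \<le> 1 / a n"
    proof (cases n)
      case 0
      then show ?thesis using r by (simp add: a_def)
    next
      case (Suc k)
      then have "\<not> 1 / a (Suc k) < r" unfolding n_def by (intro not_less_Least) simp
      then show ?thesis using Suc by simp
    qed
    have q2: "Q (Suc n) \<ge> 2" using Q_ge_2 by simp
    \<comment> \<open>The step back costs only a factor \<open>2\<close>, however large
      \<open>Q (Suc n)\<close> is; \<open>a (Suc n)\<close> itself has no upper bound in terms of
      \<open>r\<close>.\<close>
    have mS: "a (Suc n) * cylinder_mass (Suc n) \<le> 2 * (a n * cylinder_mass n)"
    proof -
      have "real (Q (Suc n) - c) \<ge> real (Q (Suc n)) - 1" using c_le_1 by linarith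
      then have "real (Q (Suc n)) / real (Q (Suc n) - c) \<le> 2"
        using q2 by (auto simp: divide_le_eq)
      moreover have "a (Suc n) * cylinder_mass (Suc n) =
          real (Q (Suc n)) / real (Q (Suc n) - c) * (a n * cylinder_mass n)"
        by (simp add: a_def cylinder_mass_def)
      ultimately show ?thesis
        using mult_nonneg_nonneg[OF less_imp_le[OF a[of n]] cylinder_mass_nonneg[of n]]
        by (simp only: mult_right_mono)
    qed
    have "2 \<le> 2 * (r * a (Suc n))" using n a[of "Suc n"] by (simp add: divide_less_eq)
    have "measure P {\<omega>. cantor_value Q \<omega> \<in> {u..v}} \<le> (r * a (Suc n) + 2) * cylinder_mass (Suc n)"
      using measure_interval_le[of u v "Suc n"] uv by (simp add: r_def a_def del: base_prod_Suc)
    also have "\<dots> \<le> (3 * (r * a (Suc n))) * cylinder_mass (Suc n)"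
      using \<open>2 \<le> 2 * (r * a (Suc n))\<close> by (intro mult_right_mono cylinder_mass_nonneg) simp
    also have "\<dots> = 3 * r * (a (Suc n) * cylinder_mass (Suc n))" by simp
    also have "\<dots> \<le> 3 * r * (2 * (a n * cylinder_mass n))"
      using r by (intro mult_left_mono mS) simp
    also have "\<dots> \<le> 3 * r * (2 * (2 ^ min n N * a n powr (1 - s)))"
      unfolding a_def using r s N
      by (intro mult_left_mono base_prod_cylinder_mass_le) auto
    also have "\<dots> \<le> 3 * r * (2 * (2 ^ N * r powr (s - 1)))"
    proof -
      have "a n \<le> 1 / r" using n' r a[of n] by (simp add: field_simps)
      then have "a n powr (1 - s) \<le> (1 / r) powr (1 - s)"
        using s a[of n] by (intro powr_mono2) auto
      also have "\<dots> = r powr (s - 1)" using r by (simp add: powr_divide powr_diff)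
      finally have "a n powr (1 - s) \<le> r powr (s - 1)" .
      then have "2 ^ min n N * a n powr (1 - s) \<le> 2 ^ N * r powr (s - 1)"
        by (intro mult_mono power_increasing) auto
      then show ?thesis using r by simp
    qed
    also have "\<dots> = C * r powr s" using r by (simp add: C_def powr_diff)
    finally show ?thesis by (simp add: r_def)
  qed
  then show ?thesis by blast
qed

lemma hausdorff_dim_eq_1_if_AE:
  assumes "AE \<omega> in P. cantor_value Q \<omega> \<in> A"
  shows "hausdorff_dim A = 1"
proof (rule hausdorff_dim_real_eq_1)
  fix s :: real assume s: "0 \<le> s" "s < 1"
  interpret prob_space P by (rule prob_space_P)
  obtain C where "\<And>u v. u < v \<Longrightarrow> v - u \<le> 1 \<Longrightarrow>
      prob {\<omega>. cantor_value Q \<omega> \<in> {u..v}} \<le> C * (v - u) powr s"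
    using measure_interval_holder[OF s] by auto
  then show "hausdorff_measure s A \<noteq> 0"
    using s assms by (intro mass_distribution_principle[of "cantor_value Q" _ _ C]) auto
qed

section \<open>The uniform law and missing digits for \<open>c = 0\<close>\<close>

lemma AE_cantor_value_bounds: "AE \<omega> in P. cantor_value Q \<omega> \<in> {0..1}"
  using AE_digits_in_range
proof eventually_elim
  case (elim \<omega>)
  then show ?case using cantor_value_bounds[OF basic, of \<omega> 0] by auto
qed

text \<open>For \<open>c = 0\<close> a cylinder mass is exactly \<open>1 / base_prod Q n\<close>,
  and the contribution of the boundary cylinders vanishes as \<open>n\<close> grows.\<close>

lemma measure_interval_le_length:
  assumes "c = 0" "u \<le> v"
  shows "measure P {\<omega>. cantor_value Q \<omega> \<in> {u..v}} \<le> v - u"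
proof -
  have "cylinder_mass n = 1 / real (base_prod Q n)" for n
    unfolding cylinder_mass_def base_prod_def using \<open>c = 0\<close> by (simp add: prod_dividef)
  moreover have "real (base_prod Q n) > 0" for n using base_prod_pos[OF basic] by simp
  ultimately have "measure P {\<omega>. cantor_value Q \<omega> \<in> {u..v}} \<le> (v - u) + 2 * (1 / real (base_prod Q n))" for n
    using measure_interval_le[OF \<open>u \<le> v\<close>, of n] by (simp add: add_divide_distrib)
  moreover have "(\<lambda>n. (v - u) + 2 * (1 / real (base_prod Q n))) \<longlonglongrightarrow> (v - u) + 2 * 0"
    by (intro tendsto_intros inverse_base_prod_tendsto_0 basic)
  ultimately have "measure P {\<omega>. cantor_value Q \<omega> \<in> {u..v}} \<le> (v - u) + 2 * 0"
    by (intro LIMSEQ_le_const) auto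
  then show ?thesis by simp
qed

text \<open>For \<open>x\<close> in the unit interval, the masses to the left and right of
  \<open>x\<close> are at most \<open>x\<close> and \<open>1 - x\<close>. They add up to
  \<open>1\<close>, so both bounds are equalities.\<close>

lemma measure_cantor_value_greater:
  assumes "c = 0"
  shows "measure P {\<omega>. x < cantor_value Q \<omega>} = max 0 (min 1 (1 - x))"
proof -
  interpret prob_space P by (rule prob_space_P)
  have ev: "{\<omega>. cantor_value Q \<omega> \<in> B} \<in> events" if "B \<in> sets borel" for B
    using measurable_sets[OF measurable_cantor_value that] by (simp add: vimage_def)
  have Ioi: "{\<omega>. x < cantor_value Q \<omega>} \<in> events" using ev[of "{x<..}"] by simp
  have split: "prob {\<omega>. x < cantor_value Q \<omega>} = 1 - prob {\<omega>. cantor_value Q \<omega> \<in> {..x}}"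
  proof -
    have "{\<omega>. x < cantor_value Q \<omega>} = space P - {\<omega>. cantor_value Q \<omega> \<in> {..x}}" by auto
    then show ?thesis using prob_compl[OF ev[of "{..x}"]] by simp
  qed
  consider "x < 0" | "0 \<le> x" "x \<le> 1" | "x > 1" by linarith
  then show ?thesis
  proof cases
    case 1
    have "AE \<omega> in P. x < cantor_value Q \<omega>"
      using AE_cantor_value_bounds by eventually_elim (use 1 in auto)
    then have "prob {\<omega>. x < cantor_value Q \<omega>} = 1"
      using Ioi prob_Collect_eq_1[of "\<lambda>\<omega>. x < cantor_value Q \<omega>"] by simp
    then show ?thesis using 1 by simp
  next
    case 2
    have "prob {\<omega>. x < cantor_value Q \<omega>} \<le> prob {\<omega>. cantor_value Q \<omega> \<in> {x..1}}"
    proof (intro finite_measure_mono_AE ev)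
      show "AE \<omega> in P. \<omega> \<in> {\<omega>. x < cantor_value Q \<omega>} \<longrightarrow> \<omega> \<in> {\<omega>. cantor_value Q \<omega> \<in> {x..1}}"
        using AE_cantor_value_bounds by eventually_elim auto
    qed simp
    also have "\<dots> \<le> 1 - x" using assms 2 by (intro measure_interval_le_length) auto
    finally have "prob {\<omega>. x < cantor_value Q \<omega>} \<le> 1 - x" .
    moreover have "prob {\<omega>. cantor_value Q \<omega> \<in> {..x}} \<le> prob {\<omega>. cantor_value Q \<omega> \<in> {0..x}}"
    proof (intro finite_measure_mono_AE ev)
      show "AE \<omega> in P. \<omega> \<in> {\<omega>. cantor_value Q \<omega> \<in> {..x}} \<longrightarrow> \<omega> \<in> {\<omega>. cantor_value Q \<omega> \<in> {0..x}}"
        using AE_cantor_value_bounds by eventually_elim auto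
    qed simp
    then have "prob {\<omega>. cantor_value Q \<omega> \<in> {..x}} \<le> x - 0"
      using measure_interval_le_length[OF assms, of 0 x] 2 by linarith
    ultimately show ?thesis using split 2 by simp
  next
    case 3
    have "AE \<omega> in P. \<not> x < cantor_value Q \<omega>"
      using AE_cantor_value_bounds by eventually_elim (use 3 in auto)
    then have "prob {\<omega>. x < cantor_value Q \<omega>} = 0"
      using Ioi prob_Collect_eq_0[of "\<lambda>\<omega>. x < cantor_value Q \<omega>"] by simp
    then show ?thesis using 3 by simp
  qed
qed

text \<open>
  The digit \<open>k\<close> can only occur at places \<open>n\<close> with \<open>Q n > k\<close>. For large \<open>k\<close> these lie in a tail of the
  convergent series, so the probability that \<open>k\<close> occurs at all tends to \<open>0\<close>.
\<close>

lemma AE_digit_missing: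
  assumes "c = 0" and conv: "one_convergent Q"
  shows "AE \<omega> in P. \<exists>k. \<forall>n\<ge>1. \<omega> n \<noteq> k"
proof -
  interpret prob_space P by (rule prob_space_P)
  \<comment> \<open>The range condition is included so that an occurrence of \<open>k\<close> at
    place \<open>n\<close> forces \<open>Q n > k\<close>; it holds almost surely and is removed at
    the end.\<close>
  define B where "B = {\<omega>. (\<forall>k. \<exists>n\<in>{1..}. \<omega> n = k) \<and> (\<forall>n\<in>{1..}. \<omega> n < Q n)}"
  have B_events: "B \<in> events"
  proof -
    have "{\<omega> \<in> space P. (\<forall>k. \<exists>n\<in>{1..}. \<omega> n = k) \<and> (\<forall>n\<in>{1..}. \<omega> n < Q n)} \<in> events"
      by measurable
    then show ?thesis by (simp add: B_def)
  qed
  have summ: "summable (\<lambda>n. 1 / real (Q (Suc n)))"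
    using conv by (simp add: one_convergent_def one_divergent_def)
  have "prob B \<le> 0 + e" if "e > 0" for e
  proof -
    obtain N where N: "norm (\<Sum>i. 1 / real (Q (Suc (i + N)))) < e"
      using suminf_exist_split[OF \<open>e > 0\<close> summ] by auto
    \<comment> \<open>The sum dominates every base up to place \<open>N\<close>, so a digit in range
      can equal \<open>k\<close> only after \<open>N\<close>.\<close>
    define k where "k = (\<Sum>n\<le>N. Q n)"
    have k: "Q n \<le> k" if "n \<le> N" for n using that unfolding k_def by (intro member_le_sum) auto
    define S where "S i = {\<omega>. \<omega> (Suc (i + N)) \<in> {k}}" for i
    have S_events: "S i \<in> events" for i unfolding S_def by (rule sets_digit)
    have S_le: "prob (S i) \<le> 1 / real (Q (Suc (i + N)))" for i
    proof -
      have "prob (S i) = real (card ({c..<Q (Suc (i + N))} \<inter> {k})) / real (Q (Suc (i + N)) - c)"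
        unfolding S_def measure_single_digit by (rule measure_digit) simp
      also have "\<dots> \<le> 1 / real (Q (Suc (i + N)) - c)"
        using card_mono[of "{k}" "{c..<Q (Suc (i + N))} \<inter> {k}"] by (intro divide_right_mono) auto
      finally show ?thesis using \<open>c = 0\<close> by simp
    qed
    have summN: "summable (\<lambda>i. 1 / real (Q (Suc (i + N))))"
      using summable_ignore_initial_segment[OF summ, of N] by simp
    then have summS: "summable (\<lambda>i. prob (S i))"
      by (rule summable_comparison_test'[of _ 0]) (use S_le in auto)
    have "B \<subseteq> (\<Union>i. S i)"
    proof
      fix \<omega> assume "\<omega> \<in> B"
      then obtain n where n: "n \<ge> 1" "\<omega> n = k" "\<omega> n < Q n"
        unfolding B_def atLeast_iff Ball_def Bex_def mem_Collect_eq by blast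
      then have "n > N" using k[of n] by (cases "n \<le> N") auto
      then have "\<omega> \<in> S (n - Suc N)" using n by (simp add: S_def)
      then show "\<omega> \<in> (\<Union>i. S i)" by blast
    qed
    then have "prob B \<le> prob (\<Union>i. S i)" using S_events by (intro finite_measure_mono) auto
    also have "\<dots> \<le> (\<Sum>i. prob (S i))"
      using S_events summS by (intro finite_measure_subadditive_countably) auto
    also have "\<dots> \<le> (\<Sum>i. 1 / real (Q (Suc (i + N))))" by (intro suminf_le S_le summS summN)
    also have "\<dots> \<le> e" using N by simp
    finally show ?thesis by simp
  qed
  then have "prob B \<le> 0" by (rule field_le_epsilon)
  then have "emeasure P B = 0" by (simp add: emeasure_eq_measure measure_le_0_iff)
  then have "AE \<omega> in P. \<omega> \<notin> B" using B_events by (intro AE_not_in) auto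
  then show ?thesis using AE_digits_in_range
    by eventually_elim (auto simp: B_def)
qed

end

text \<open>Both sides are the uniform distribution on the unit interval.\<close>

lemma distr_cantor_value_eq:
  assumes "random_cantor_digits Q 0" "random_cantor_digits R 0"
  shows "distr (digit_measure Q 0) borel (cantor_value Q) = distr (digit_measure R 0) borel (cantor_value R)"
proof (rule measure_eqI_lessThan)
  have em: "emeasure (distr (digit_measure Q 0) borel (cantor_value Q)) {x<..} = ennreal (max 0 (min 1 (1 - x)))"
    if "random_cantor_digits Q 0" for Q and x :: real
  proof -
    interpret random_cantor_digits Q 0 by fact
    have "emeasure (distr P borel (cantor_value Q)) {x<..} = emeasure P {\<omega>. x < cantor_value Q \<omega>}"
      by (subst emeasure_distr) (auto intro!: arg_cong[of _ _ "emeasure P"])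
    then show ?thesis
      using measure_cantor_value_greater[of x]
      by (simp add: finite_measure.emeasure_eq_measure[OF prob_space.finite_measure[OF prob_space_P]])
  qed
  show "emeasure (distr (digit_measure Q 0) borel (cantor_value Q)) {x<..} < \<infinity>" for x
    by (simp add: em assms)
  show "emeasure (distr (digit_measure Q 0) borel (cantor_value Q)) {x<..} =
      emeasure (distr (digit_measure R 0) borel (cantor_value R)) {x<..}" for x
    by (simp add: em assms)
qed simp_all

section \<open>Measurability and the convergent case\<close>

lemma measurable_cantor_digits:
  assumes "basic_sequence Q"
  shows "(\<lambda>x. cantor_digits Q x (Suc n)) \<in> borel \<rightarrow>\<^sub>M count_space UNIV"
  unfolding cantor_digits_Suc_floor[OF assms] cantor_shift_def frac_def by measurable

text \<open>Needed to move almost sure statements to the law on the real line. Rational thresholds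
  are quantified over the countable type \<open>rat\<close>, which turns the predicate into a
  countable conjunction.\<close>

lemma pred_equidistributed_cantor_digits:
  assumes "basic_sequence Q"
  shows "Measurable.pred borel (\<lambda>x. equidistributed_digits Q (cantor_digits Q x))"
proof -
  note [measurable] = measurable_cantor_digits[OF assms]
  have freq: "digit_frequency Q E D t N =
      (\<Sum>n<N. if real (E (Suc (n * D))) < t * real (Q (Suc (n * D))) then 1 else 0) / real N" for E D t N
  proof -
    have "{n. n < N \<and> real (E (Suc (n * D))) < t * real (Q (Suc (n * D)))} =
        {..<N} \<inter> {n. real (E (Suc (n * D))) < t * real (Q (Suc (n * D)))}" by auto
    then show ?thesis by (simp add: digit_frequency_def sum.If_cases)
  qed
  have [measurable]: "(\<lambda>x. digit_frequency Q (cantor_digits Q x) D t N) \<in> borel_measurable borel" for D t N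
    unfolding freq by measurable
  have "Measurable.pred borel (\<lambda>x. digit_frequency Q (cantor_digits Q x) D t \<longlonglongrightarrow> t)" for D t
    using measurable_limit2[of "\<lambda>N x. digit_frequency Q (cantor_digits Q x) D t N" borel "\<lambda>_. t"] by simp
  then have "Measurable.pred borel
      (\<lambda>x. \<forall>D\<in>{1..}. \<forall>q::rat. of_rat q \<in> {0..1::real} \<longrightarrow>
        digit_frequency Q (cantor_digits Q x) D (of_rat q) \<longlonglongrightarrow> of_rat q)"
    by measurable
  moreover have "equidistributed_digits Q E \<longleftrightarrow>
      (\<forall>D\<in>{1..}. \<forall>q::rat. of_rat q \<in> {0..1::real} \<longrightarrow> digit_frequency Q E D (of_rat q) \<longlonglongrightarrow> of_rat q)" for E
  proof -
    have "(\<forall>t\<in>\<rat> \<inter> {0..1::real}. F t) \<longleftrightarrow> (\<forall>q::rat. of_rat q \<in> {0..1::real} \<longrightarrow> F (of_rat q))" for F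
      by (blast elim: Rats_cases intro: Rats_of_rat)
    then show ?thesis unfolding equidistributed_digits_def by simp
  qed
  ultimately show ?thesis by (simp only:)
qed

text \<open>Stated for the law on the real line because that law is common to all bases, unlike the
  spaces of digit sequences.\<close>

lemma AE_distribution_normal_not_ratio_normal:
  assumes Q: "basic_sequence Q" "infinite_in_limit Q" "one_convergent Q"
  shows "AE x in distr (digit_measure Q 0) borel (cantor_value Q).
    x \<in> distribution_normal Q - simply_ratio_normal Q"
proof -
  interpret random_cantor_digits Q 0 by unfold_locales (use Q in auto)
  \<comment> \<open>A Borel condition sufficient for membership; it is transferred to the law in
    place of the target set, whose measurability is not established.\<close>
  define G where "G x \<longleftrightarrow> equidistributed_digits Q (cantor_digits Q x) \<and>
    (\<exists>k. \<forall>n. cantor_digits Q x (Suc n) \<noteq> k)" for x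
  have "Measurable.pred borel G"
  proof -
    note [measurable] = measurable_cantor_digits[OF basic] pred_equidistributed_cantor_digits[OF basic]
    show ?thesis unfolding G_def by measurable
  qed
  moreover have "AE \<omega> in P. G (cantor_value Q \<omega>)"
    using AE_cantor_expansion AE_equidistributed_digits AE_digit_missing[OF refl Q(3)]
  proof eventually_elim
    case (elim \<omega>)
    have eq: "cantor_digits Q (cantor_value Q \<omega>) n = \<omega> n" if "n \<ge> 1" for n
      using elim(1) that by (intro cantor_digits_eq basic)
    then have "equidistributed_digits Q (cantor_digits Q (cantor_value Q \<omega>))"
      using elim(2) equidistributed_digits_cong[of "cantor_digits Q (cantor_value Q \<omega>)" \<omega> Q] by blast
    moreover obtain k where "\<And>n. n \<ge> 1 \<Longrightarrow> \<omega> n \<noteq> k" using elim(3) by blast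
    then have "\<forall>n. cantor_digits Q (cantor_value Q \<omega>) (Suc n) \<noteq> k" using eq by simp
    ultimately show ?case unfolding G_def by blast
  qed
  ultimately have "AE x in distr P borel (cantor_value Q). G x"
    by (subst AE_distr_iff) auto
  then show ?thesis
  proof eventually_elim
    case (elim x)
    have "uniformly_distributed_mod1 (\<lambda>n. cantor_shift Q (n * 1) x)"
      using elim unfolding G_def
      by (intro equidistributed_digits_shift[OF basic inf_lim is_cantor_expansion_cantor_digits[OF basic]]) auto
    then have "x \<in> distribution_normal Q" by (simp add: distribution_normal_def)
    moreover obtain k where k: "\<And>n. cantor_digits Q x (Suc n) \<noteq> k" using elim unfolding G_def by blast
    have "x \<notin> simply_ratio_normal Q"
    proof (rule not_simply_ratio_normal_if_digit_missing)
      fix n :: nat assume "n \<ge> 1"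
      then show "cantor_digits Q x n \<noteq> k" using k[of "n - 1"] by simp
    qed
    ultimately show ?case by blast
  qed
qed

section \<open>Block products and the chain case\<close>

lemma block_product_rel_base_prod:
  assumes "block_product_rel s P Q"
  shows "base_prod Q n = base_prod P (n * s)"
proof (induction n)
  case (Suc n)
  have "Q (Suc n) = (\<Prod>j=1..s. P (s * n + j))" using assms by (simp add: block_product_rel_def)
  also have "\<dots> = (\<Prod>j\<in>{n * s + 1..n * s + s}. P j)"
    using prod.shift_bounds_cl_nat_ivl[of P 1 "n * s" s] by (simp add: mult.commute add.commute)
  finally have "base_prod Q (Suc n) = base_prod P (n * s) * (\<Prod>j\<in>{n * s + 1..n * s + s}. P j)"
    using Suc by simp
  also have "\<dots> = base_prod P (n * s + s)"
    unfolding base_prod_def by (rule prod.ub_add_nat[symmetric]) simp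
  finally show ?case by (simp add: add.commute)
qed simp

lemma base_prod_mono:
  assumes "basic_sequence Q" "m \<le> n"
  shows "base_prod Q m \<le> base_prod Q n"
  using assms(2)
proof (induction n rule: dec_induct)
  case (step n)
  have "Q (Suc n) \<ge> 2" using assms by (simp add: basic_sequence_def)
  then have "base_prod Q n * 1 \<le> base_prod Q (Suc n)" unfolding base_prod_Suc by (intro mult_le_mono) auto
  then show ?case using step.IH by linarith
qed simp

text \<open>Shifts depend only on the products of bases, so those of \<open>R\<close> are every
  \<open>D\<close>-th shift of \<open>Q\<close>. A first digit at least \<open>1\<close> in base
  \<open>Q\<close> bounds the shift below by \<open>1 / Q (Suc (m * D))\<close>; since
  \<open>R (Suc m)\<close> is at least this base, the digit in base \<open>R\<close> is nonzero
  too.\<close>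

lemma distribution_normal_not_ratio_normal_block_product:
  assumes Q: "basic_sequence Q" "infinite_in_limit Q" and R: "basic_sequence R"
    and D: "D \<ge> 1" and prod: "\<And>n. base_prod R n = base_prod Q (n * D)"
    and E: "is_cantor_expansion Q x E" "equidistributed_digits Q E" "\<And>n. n \<ge> 1 \<Longrightarrow> E n \<ge> 1"
  shows "x \<in> distribution_normal R - simply_ratio_normal R"
proof -
  have shift: "cantor_shift R n x = cantor_shift Q (n * D) x" for n
    using prod unfolding cantor_shift_def base_prod_def by simp
  have "x \<in> distribution_normal R"
    using equidistributed_digits_shift[OF Q E(1,2) D] by (simp add: distribution_normal_def shift)
  moreover have "x \<notin> simply_ratio_normal R"
  proof (rule not_simply_ratio_normal_if_digit_missing)
    fix n :: nat assume "n \<ge> 1"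
    then obtain m where m: "n = Suc m" by (cases n) auto
    let ?q = "real (Q (Suc (m * D)))"
    have qpos: "?q > 0" using is_cantor_expansion_lt[OF Q(1) E(1), of "Suc (m * D)"] by simp
    \<comment> \<open>From \<open>D >= 1\<close> the index \<open>Suc (m * D)\<close> is at most
      \<open>Suc m * D\<close>; cancelling the common product compares the two bases.\<close>
    have "base_prod Q (m * D) * Q (Suc (m * D)) \<le> base_prod Q (m * D) * R (Suc m)"
      using base_prod_mono[OF Q(1), of "Suc (m * D)" "Suc m * D"] D prod[of m] prod[of "Suc m"] by simp
    then have "?q \<le> real (R (Suc m))" using base_prod_pos[OF Q(1), of "m * D"] by simp
    moreover have "1 \<le> ?q * cantor_shift R m x"
      using cantor_shift_Suc[OF Q(1) E(1), of "m * D"] E(3)[of "Suc (m * D)"]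
        cantor_shift_bounds(1)[of Q "Suc (m * D)" x] unfolding shift by simp
    ultimately have "1 \<le> real (R (Suc m)) * cantor_shift R m x"
      using mult_right_mono[of ?q "real (R (Suc m))" "cantor_shift R m x"] cantor_shift_bounds(1)[of R m x]
      by linarith
    then have "1 \<le> \<lfloor>real (R (Suc m)) * cantor_shift R m x\<rfloor>" by (simp add: le_floor_iff)
    then show "cantor_digits R x n \<noteq> 0" unfolding m cantor_digits_Suc_floor[OF R] by linarith
  qed
  ultimately show ?thesis by blast
qed

theorem theorem1p3:
  fixes Q :: "nat \<Rightarrow> nat \<Rightarrow> nat"
  assumes "\<And>j. j \<ge> 1 \<Longrightarrow> basic_sequence (Q j)"
    and "\<And>j. j \<ge> 1 \<Longrightarrow> infinite_in_limit (Q j)"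
    and "(\<forall>j\<ge>1. one_convergent (Q j)) \<or>
         (one_divergent (Q 1) \<and>
          (\<exists>S. basic_sequence S \<and> (\<forall>j\<ge>1. block_product_rel (S j) (Q j) (Q (j + 1)))))"
  shows "hausdorff_dim (\<Inter>j\<in>{1..}. distribution_normal (Q j) - simply_ratio_normal (Q j)) = 1"
  using assms(3)
proof (elim disjE conjE exE)
  assume conv: "\<forall>j\<ge>1. one_convergent (Q j)"
  have rcd: "random_cantor_digits (Q j) 0" if "j \<ge> 1" for j
    by unfold_locales (use assms that in auto)
  interpret random_cantor_digits "Q 1" 0 by (rule rcd) simp
  have "AE x in distr P borel (cantor_value (Q 1)).
      x \<in> distribution_normal (Q j) - simply_ratio_normal (Q j)" if "j \<in> {1..}" for j
  proof -
    \<comment> \<open>Equality of the laws brings the statements for all \<open>j\<close> to one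
      measure, where countably many of them hold simultaneously.\<close>
    have "distr P borel (cantor_value (Q 1)) = distr (digit_measure (Q j) 0) borel (cantor_value (Q j))"
      using that by (intro distr_cantor_value_eq rcd) auto
    then show ?thesis
      using assms conv that by (simp only:) (intro AE_distribution_normal_not_ratio_normal, auto)
  qed
  then have "AE x in distr P borel (cantor_value (Q 1)).
      \<forall>j\<in>{1..}. x \<in> distribution_normal (Q j) - simply_ratio_normal (Q j)"
    by (subst AE_ball_countable) auto
  then have "AE \<omega> in P. \<forall>j\<in>{1..}. cantor_value (Q 1) \<omega> \<in> distribution_normal (Q j) - simply_ratio_normal (Q j)"
    by (rule AE_distrD[OF measurable_cantor_value])
  then show ?thesis by (intro hausdorff_dim_eq_1_if_AE) (auto elim!: eventually_mono)
next
  fix S assume S: "basic_sequence S" and rel: "\<forall>j\<ge>1. block_product_rel (S j) (Q j) (Q (j + 1))"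
  interpret random_cantor_digits "Q 1" 1 by unfold_locales (use assms in auto)
  \<comment> \<open>The witness \<open>D\<close> is the product of \<open>S 1\<close> up to
    \<open>S j\<close>; indexing by \<open>Suc j\<close> lets the induction start at
    \<open>Q 1\<close> with the empty product.\<close>
  have chain: "\<exists>D\<ge>1. \<forall>n. base_prod (Q (Suc j)) n = base_prod (Q 1) (n * D)" for j
  proof (induction j)
    case 0
    show ?case by (intro exI[of _ 1]) simp
  next
    case (Suc j)
    then obtain D where D: "D \<ge> 1" "\<And>n. base_prod (Q (Suc j)) n = base_prod (Q 1) (n * D)" by auto
    have "S (Suc j) \<ge> 2" using S by (simp add: basic_sequence_def)
    then have "S (Suc j) * D \<ge> 1" using D by simp
    moreover have "block_product_rel (S (Suc j)) (Q (Suc j)) (Q (Suc (Suc j)))"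
      using rel[rule_format, of "Suc j"] by simp
    ultimately show ?case
      using D by (intro exI[of _ "S (Suc j) * D"]) (simp add: block_product_rel_base_prod mult.assoc)
  qed
  have "AE \<omega> in P. cantor_value (Q 1) \<omega> \<in> (\<Inter>j\<in>{1..}. distribution_normal (Q j) - simply_ratio_normal (Q j))"
    using AE_cantor_expansion AE_equidistributed_digits AE_digits_in_range
  proof eventually_elim
    case (elim \<omega>)
    show ?case
    proof
      fix j :: nat assume j: "j \<in> {1..}"
      then obtain D where D: "D \<ge> 1" "\<And>n. base_prod (Q j) n = base_prod (Q 1) (n * D)"
        using chain[of "j - 1"] by auto
      show "cantor_value (Q 1) \<omega> \<in> distribution_normal (Q j) - simply_ratio_normal (Q j)"
        using elim j D assms(1)
        by (intro distribution_normal_not_ratio_normal_block_product[OF basic inf_lim, of _ D _ \<omega>]) auto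
    qed
  qed
  then show ?thesis by (rule hausdorff_dim_eq_1_if_AE)
qed

end
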